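(* Let $R$ be a commutative ring and let $\mathfrak F$ be the family of functors of $\mathcal R$-modules defined in the context. Let $\mathbb A\in\mathfrak F$ be a functor of $\mathcal R$-algebras and let $\mathbb M,\mathbb M'\in\mathfrak F$ be functors of $\mathbb A$-modules. Then a morphism of $\mathcal R$-modules $f\colon\mathbb M\to\mathbb M'$ is a morphism of $\mathbb A$-modules if and only if $f_R\colon\mathbb M(R)\to\mathbb M'(R)$ is a morphism of $\mathbb A(R)$-modules.
   Context: $R$ is a commutative ring with unit. All functors are covariant functors on the category of commutative $R$-algebras. $\mathcal R$ is the functor of rings $\mathcal R(S)=S$. A functor of $\mathcal R$-modules $\mathbb M$ is a functor of sets with morphisms of functors $\mathbb M\times\mathbb M\to\mathbb M$, $\mathcal R\times\mathbb M\to\mathbb M$ making $\mathbb M(S)$ an $S$-module for every commutative $R$-algebra $S$. Morphisms are natural transformations $f$ with every $f_S$ $S$-linear. $\mathbb M^*(S):=\operatorname{Hom}_{\mathcal S}(\mathbb M_{|S},\mathcal S)$, where $\mathbb M_{|S}$ is the restriction to commutative $S$-algebras and $\mathcal S(T)=T$. A dual functor of $\mathcal R$-modules is one of the form $\mathbb N^*$ (up to isomorphism) for a functor of $\mathcal R$-modules $\mathbb N$ (only functors for which the Hom's involved are sets are considered). A functor of $\mathcal R$-algebras is a functor $\mathbb A$ of (associative unital, not necessarily commutative) rings with a morphism of functors of rings $\mathcal R\to\mathbb A$ such that $S$ is central in $\mathbb A(S)$ for all $S$. Functors of $\mathbb A$-modules are functors of $\mathcal R$-modules with a compatible pointwise $\mathbb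 A(S)$-module structure, functorial in $S$. For a set $J$, $\bigoplus_J\mathcal R$ and $\prod_J\mathcal R$ are the functors $S\mapsto\bigoplus_J S$, $S\mapsto\prod_J S$; $\prod_J\mathcal R$ is a functor of $\mathcal R$-algebras with componentwise multiplication, and $\bigoplus_J\mathcal R$, $\prod_J\mathcal R$ are functors of $\prod_J\mathcal R$-modules. Definition of $\mathfrak F$: it is the family of dual functors of $\mathcal R$-modules $\mathbb M$ such that there exist a set $J$ (depending on $\mathbb M$), a structure of functor of $\prod_J\mathcal R$-modules on $\mathbb M$ (extending its $\mathcal R$-module structure) and inclusions of functors of $\prod_J\mathcal R$-modules $\bigoplus_J\mathcal R\subseteq\mathbb M\subseteq\prod_J\mathcal R$ whose composite $\bigoplus_J\mathcal R\subseteq\prod_J\mathcal R$ is the obvious inclusion. *)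

theory Defs
  imports "HOL-Algebra.Module"
begin

text \<open>
  The type \<open>'u\<close> plays the role of the universe: the base ring \<open>R\<close> and all
  commutative \<open>R\<close>-algebras have their carriers in \<open>'u\<close>, and the index sets \<open>J\<close> are sets of
  elements of \<open>'u\<close>.  Values of functors may live in arbitrary other types.  Commutative
  \<open>R\<close>-algebras are the structures \<open>S :: ('u, 'u) module\<close> with \<open>algebra R S\<close>.
\<close>

section \<open>Commutative algebras\<close>

text \<open>Homomorphisms are extensional, so that they are determined by their values on the carrier.\<close>

definition algebra_hom ::
  "('u, 'x) ring_scheme \<Rightarrow> ('u, 'u) module \<Rightarrow> ('u, 'u) module \<Rightarrow> ('u \<Rightarrow> 'u) set" where
  "algebra_hom R S T =
     {h \<in> ring_hom S T \<inter> extensional (carrier S).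
        \<forall>r\<in>carrier R. \<forall>x\<in>carrier S. h (r \<odot>\<^bsub>S\<^esub> x) = r \<odot>\<^bsub>T\<^esub> h x}"

definition self_algebra :: "('u, 'x) ring_scheme \<Rightarrow> ('u, 'u) module" where
  "self_algebra R =
     \<lparr>carrier = carrier R, mult = mult R, one = one R, zero = zero R, add = add R,
      smult = mult R\<rparr>"

text \<open>
  Restriction of scalars of a \<open>B\<close>-algebra \<open>U\<close> along \<open>h : A \<rightarrow> B\<close>.  Making the new scalar
  multiplication undefined outside \<open>carrier A\<close> renders iterated restrictions equal as records.
\<close>

definition restrict_scalars ::
  "('u, 'x) ring_scheme \<Rightarrow> ('u \<Rightarrow> 'u) \<Rightarrow> ('u, 'u) module \<Rightarrow> ('u, 'u) module" where
  "restrict_scalars A h U = U\<lparr>smult := (\<lambda>a\<in>carrier A. smult U (h a))\<rparr>"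

abbreviation base_restrict ::
  "('u, 'x) ring_scheme \<Rightarrow> ('u, 'u) module \<Rightarrow> ('u, 'u) module \<Rightarrow> ('u, 'u) module" where
  "base_restrict R S T \<equiv> restrict_scalars R (\<lambda>r. r \<odot>\<^bsub>S\<^esub> \<one>\<^bsub>S\<^esub>) T"

section \<open>Functors on commutative algebras\<close>

text \<open>
  \<open>'o\<close> is the type of the structures which the functor takes as values, \<open>'m\<close> the type of
  their elements.
\<close>

record ('u, 'o, 'm) alg_functor =
  obj :: "('u, 'u) module \<Rightarrow> 'o"
  arr :: "('u, 'u) module \<Rightarrow> ('u, 'u) module \<Rightarrow> ('u \<Rightarrow> 'u) \<Rightarrow> 'm \<Rightarrow> 'm"

type_synonym ('u, 'm) mod_functor = "('u, ('u, 'm) module, 'm) alg_functor"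
type_synonym ('u, 'm) rng_functor = "('u, 'm ring, 'm) alg_functor"

locale set_functor =
  fixes R :: "('u, 'x) ring_scheme"
    and F :: "('u, ('m, 'z) partial_object_scheme, 'm) alg_functor"
  assumes arr_closed:
      "\<lbrakk>algebra R S; algebra R T; h \<in> algebra_hom R S T; x \<in> carrier (obj F S)\<rbrakk>
       \<Longrightarrow> arr F S T h x \<in> carrier (obj F T)"
    and arr_id:
      "\<lbrakk>algebra R S; x \<in> carrier (obj F S)\<rbrakk> \<Longrightarrow> arr F S S (\<lambda>s\<in>carrier S. s) x = x"
    and arr_comp:
      "\<lbrakk>algebra R S; algebra R T; algebra R U; h \<in> algebra_hom R S T; k \<in> algebra_hom R T U;
        x \<in> carrier (obj F S)\<rbrakk>
       \<Longrightarrow> arr F S U (compose (carrier S) k h) x = arr F T U k (arr F S T h x)"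

definition natural_transformation ::
  "('u, 'x) ring_scheme \<Rightarrow> ('u, ('m, 'y) partial_object_scheme, 'm) alg_functor \<Rightarrow>
   ('u, ('n, 'z) partial_object_scheme, 'n) alg_functor \<Rightarrow>
   (('u, 'u) module \<Rightarrow> 'm \<Rightarrow> 'n) \<Rightarrow> bool" where
  "natural_transformation R F G f \<longleftrightarrow>
     (\<forall>S. algebra R S \<longrightarrow> f S \<in> carrier (obj F S) \<rightarrow> carrier (obj G S)) \<and>
     (\<forall>S T h. algebra R S \<longrightarrow> algebra R T \<longrightarrow> h \<in> algebra_hom R S T \<longrightarrow>
        (\<forall>x\<in>carrier (obj F S). f T (arr F S T h x) = arr G S T h (f S x)))"

section \<open>Functors of modules and their duals\<close>

locale module_functor = set_functor R M
  for R :: "('u, 'x) ring_scheme" and M :: "('u, 'm) mod_functor" +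
  assumes module_obj: "algebra R S \<Longrightarrow> module S (obj M S)"
    and arr_add:
      "\<lbrakk>algebra R S; algebra R T; h \<in> algebra_hom R S T;
        x \<in> carrier (obj M S); y \<in> carrier (obj M S)\<rbrakk>
       \<Longrightarrow> arr M S T h (x \<oplus>\<^bsub>obj M S\<^esub> y) = arr M S T h x \<oplus>\<^bsub>obj M T\<^esub> arr M S T h y"
    and arr_smult:
      "\<lbrakk>algebra R S; algebra R T; h \<in> algebra_hom R S T;
        s \<in> carrier S; x \<in> carrier (obj M S)\<rbrakk>
       \<Longrightarrow> arr M S T h (s \<odot>\<^bsub>obj M S\<^esub> x) = h s \<odot>\<^bsub>obj M T\<^esub> arr M S T h x"

definition module_morphism ::
  "('u, 'x) ring_scheme \<Rightarrow> ('u, 'm) mod_functor \<Rightarrow> ('u, 'n) mod_functor \<Rightarrow>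
   (('u, 'u) module \<Rightarrow> 'm \<Rightarrow> 'n) \<Rightarrow> bool" where
  "module_morphism R M N f \<longleftrightarrow>
     natural_transformation R M N f \<and>
     (\<forall>S. algebra R S \<longrightarrow>
        (\<forall>x\<in>carrier (obj M S). \<forall>y\<in>carrier (obj M S).
           f S (x \<oplus>\<^bsub>obj M S\<^esub> y) = f S x \<oplus>\<^bsub>obj N S\<^esub> f S y) \<and>
        (\<forall>s\<in>carrier S. \<forall>x\<in>carrier (obj M S).
           f S (s \<odot>\<^bsub>obj M S\<^esub> x) = s \<odot>\<^bsub>obj N S\<^esub> f S x))"

definition module_isomorphism ::
  "('u, 'x) ring_scheme \<Rightarrow> ('u, 'm) mod_functor \<Rightarrow> ('u, 'n) mod_functor \<Rightarrow>
   (('u, 'u) module \<Rightarrow> 'm \<Rightarrow> 'n) \<Rightarrow> bool" where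
  "module_isomorphism R M N f \<longleftrightarrow>
     module_morphism R M N f \<and>
     (\<forall>S. algebra R S \<longrightarrow> bij_betw (f S) (carrier (obj M S)) (carrier (obj N S)))"

definition scalar_functor :: "('u, 'u) mod_functor" where
  "scalar_functor = \<lparr>obj = self_algebra, arr = (\<lambda>S T h. h)\<rparr>"

definition restrict_functor ::
  "('u, 'x) ring_scheme \<Rightarrow> ('u, 'u) module \<Rightarrow> ('u, 'm) mod_functor \<Rightarrow> ('u, 'm) mod_functor" where
  "restrict_functor R S M =
     \<lparr>obj = (\<lambda>T. obj M (base_restrict R S T)),
      arr = (\<lambda>T U. arr M (base_restrict R S T) (base_restrict R S U))\<rparr>"

text \<open>
  \<^const>\<open>module_morphism\<close> only concerns the values on algebras and on carriers; the elements of
  \<open>Hom\<close> are the extensional representatives.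
\<close>

definition Hom_functor ::
  "('u, 'x) ring_scheme \<Rightarrow> ('u, 'm) mod_functor \<Rightarrow> ('u, 'n) mod_functor \<Rightarrow>
   (('u, 'u) module \<Rightarrow> 'm \<Rightarrow> 'n) set" where
  "Hom_functor R M N =
     {f \<in> PiE {S. algebra R S} (\<lambda>S. extensional (carrier (obj M S))). module_morphism R M N f}"

text \<open>
  \<open>M\<^sup>*(S)\<close> is \<open>Hom\<close> over \<open>S\<close> from the restriction of \<open>M\<close> to \<open>S\<close>-algebras to the scalar functor;
  the ring multiplication and unit fields of the record are irrelevant.
\<close>

definition dual_functor ::
  "('u, 'x) ring_scheme \<Rightarrow> ('u, 'm) mod_functor \<Rightarrow>
   ('u, ('u, 'u) module \<Rightarrow> 'm \<Rightarrow> 'u) mod_functor" where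
  "dual_functor R M =
     \<lparr>obj = (\<lambda>S.
        \<lparr>carrier = Hom_functor S (restrict_functor R S M) scalar_functor,
         mult = undefined,
         one = undefined,
         zero = (\<lambda>T\<in>{T. algebra S T}. \<lambda>x\<in>carrier (obj (restrict_functor R S M) T). \<zero>\<^bsub>T\<^esub>),
         add = (\<lambda>f g. \<lambda>T\<in>{T. algebra S T}.
                  \<lambda>x\<in>carrier (obj (restrict_functor R S M) T). f T x \<oplus>\<^bsub>T\<^esub> g T x),
         smult = (\<lambda>s f. \<lambda>T\<in>{T. algebra S T}.
                  \<lambda>x\<in>carrier (obj (restrict_functor R S M) T). s \<odot>\<^bsub>T\<^esub> f T x)\<rparr>),
      arr = (\<lambda>S T h f. \<lambda>U\<in>{U. algebra T U}. f (restrict_scalars S h U))\<rparr>"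

text \<open>The type argument provides the elements of the values of the functor \<open>N\<close> with \<open>M \<cong> N\<^sup>*\<close>.\<close>

definition is_dual_functor ::
  "'n itself \<Rightarrow> ('u, 'x) ring_scheme \<Rightarrow> ('u, 'm) mod_functor \<Rightarrow> bool" where
  "is_dual_functor _ R M \<longleftrightarrow>
     module_functor R M \<and>
     (\<exists>(N :: ('u, 'n) mod_functor) f.
        module_functor R N \<and> module_isomorphism R M (dual_functor R N) f)"

section \<open>Functors of algebras and functors of modules over them\<close>

text \<open>\<open>\<iota>\<close> is the structure morphism from the scalar functor to \<open>A\<close>.\<close>

locale algebra_functor = set_functor R A
  for R :: "('u, 'x) ring_scheme" and A :: "('u, 'a) rng_functor" +
  fixes \<iota> :: "('u, 'u) module \<Rightarrow> 'u \<Rightarrow> 'a"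
  assumes ring_obj: "algebra R S \<Longrightarrow> ring (obj A S)"
    and ring_arr:
      "\<lbrakk>algebra R S; algebra R T; h \<in> algebra_hom R S T\<rbrakk>
       \<Longrightarrow> arr A S T h \<in> ring_hom (obj A S) (obj A T)"
    and unit_natural: "natural_transformation R scalar_functor A \<iota>"
    and unit_ring_hom: "algebra R S \<Longrightarrow> \<iota> S \<in> ring_hom S (obj A S)"
    and unit_central:
      "\<lbrakk>algebra R S; s \<in> carrier S; a \<in> carrier (obj A S)\<rbrakk>
       \<Longrightarrow> \<iota> S s \<otimes>\<^bsub>obj A S\<^esub> a = a \<otimes>\<^bsub>obj A S\<^esub> \<iota> S s"

definition underlying_module_functor ::
  "('u, 'a) rng_functor \<Rightarrow> (('u, 'u) module \<Rightarrow> 'u \<Rightarrow> 'a) \<Rightarrow> ('u, 'a) mod_functor" where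
  "underlying_module_functor A \<iota> =
     \<lparr>obj = (\<lambda>S.
        \<lparr>carrier = carrier (obj A S), mult = mult (obj A S), one = one (obj A S),
         zero = zero (obj A S), add = add (obj A S),
         smult = (\<lambda>s a. \<iota> S s \<otimes>\<^bsub>obj A S\<^esub> a)\<rparr>),
      arr = arr A\<rparr>"

text \<open>The library's \<^locale>\<open>module\<close> requires commutative scalars.\<close>

locale left_module = A?: ring A + X?: abelian_group X
  for A :: "('a, 'y) ring_scheme" and X :: "('m, 'z) ring_scheme" +
  fixes act :: "'a \<Rightarrow> 'm \<Rightarrow> 'm"
  assumes act_closed: "\<lbrakk>a \<in> carrier A; x \<in> carrier X\<rbrakk> \<Longrightarrow> act a x \<in> carrier X"
    and act_l_distr:
      "\<lbrakk>a \<in> carrier A; b \<in> carrier A; x \<in> carrier X\<rbrakk>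
       \<Longrightarrow> act (a \<oplus>\<^bsub>A\<^esub> b) x = act a x \<oplus>\<^bsub>X\<^esub> act b x"
    and act_r_distr:
      "\<lbrakk>a \<in> carrier A; x \<in> carrier X; y \<in> carrier X\<rbrakk>
       \<Longrightarrow> act a (x \<oplus>\<^bsub>X\<^esub> y) = act a x \<oplus>\<^bsub>X\<^esub> act a y"
    and act_assoc:
      "\<lbrakk>a \<in> carrier A; b \<in> carrier A; x \<in> carrier X\<rbrakk>
       \<Longrightarrow> act (a \<otimes>\<^bsub>A\<^esub> b) x = act a (act b x)"
    and act_one: "x \<in> carrier X \<Longrightarrow> act \<one>\<^bsub>A\<^esub> x = x"

definition left_module_hom ::
  "('a, 'y) ring_scheme \<Rightarrow> ('m, 'z) ring_scheme \<Rightarrow> ('a \<Rightarrow> 'm \<Rightarrow> 'm) \<Rightarrow>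
   ('n, 'w) ring_scheme \<Rightarrow> ('a \<Rightarrow> 'n \<Rightarrow> 'n) \<Rightarrow> ('m \<Rightarrow> 'n) set" where
  "left_module_hom A X act Y act' =
     {g \<in> carrier X \<rightarrow> carrier Y.
        (\<forall>x\<in>carrier X. \<forall>y\<in>carrier X. g (x \<oplus>\<^bsub>X\<^esub> y) = g x \<oplus>\<^bsub>Y\<^esub> g y) \<and>
        (\<forall>a\<in>carrier A. \<forall>x\<in>carrier X. g (act a x) = act' a (g x))}"

locale algebra_module_functor = algebra_functor R A \<iota> + M: module_functor R M
  for R :: "('u, 'x) ring_scheme" and A :: "('u, 'a) rng_functor" and \<iota>
    and M :: "('u, 'm) mod_functor" +
  fixes act :: "('u, 'u) module \<Rightarrow> 'a \<Rightarrow> 'm \<Rightarrow> 'm"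
  assumes left_module_obj: "algebra R S \<Longrightarrow> left_module (obj A S) (obj M S) (act S)"
    and act_compatible:
      "\<lbrakk>algebra R S; s \<in> carrier S; x \<in> carrier (obj M S)\<rbrakk>
       \<Longrightarrow> act S (\<iota> S s) x = s \<odot>\<^bsub>obj M S\<^esub> x"
    and act_natural:
      "\<lbrakk>algebra R S; algebra R T; h \<in> algebra_hom R S T;
        a \<in> carrier (obj A S); x \<in> carrier (obj M S)\<rbrakk>
       \<Longrightarrow> arr M S T h (act S a x) = act T (arr A S T h a) (arr M S T h x)"

definition algebra_module_morphism ::
  "('u, 'x) ring_scheme \<Rightarrow> ('u, 'a) rng_functor \<Rightarrow>
   ('u, 'm) mod_functor \<Rightarrow> (('u, 'u) module \<Rightarrow> 'a \<Rightarrow> 'm \<Rightarrow> 'm) \<Rightarrow>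
   ('u, 'n) mod_functor \<Rightarrow> (('u, 'u) module \<Rightarrow> 'a \<Rightarrow> 'n \<Rightarrow> 'n) \<Rightarrow>
   (('u, 'u) module \<Rightarrow> 'm \<Rightarrow> 'n) \<Rightarrow> bool" where
  "algebra_module_morphism R A M act N act' f \<longleftrightarrow>
     natural_transformation R M N f \<and>
     (\<forall>S. algebra R S \<longrightarrow>
        f S \<in> left_module_hom (obj A S) (obj M S) (act S) (obj N S) (act' S))"

section \<open>Products, direct sums, and the family of functors\<close>

definition product_functor :: "'u set \<Rightarrow> ('u, 'u \<Rightarrow> 'u) rng_functor" where
  "product_functor J =
     \<lparr>obj = (\<lambda>S.
        \<lparr>carrier = J \<rightarrow>\<^sub>E carrier S,
         mult = (\<lambda>x y. \<lambda>j\<in>J. x j \<otimes>\<^bsub>S\<^esub> y j),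
         one = (\<lambda>j\<in>J. \<one>\<^bsub>S\<^esub>),
         zero = (\<lambda>j\<in>J. \<zero>\<^bsub>S\<^esub>),
         add = (\<lambda>x y. \<lambda>j\<in>J. x j \<oplus>\<^bsub>S\<^esub> y j)\<rparr>),
      arr = (\<lambda>S T h x. \<lambda>j\<in>J. h (x j))\<rparr>"

definition product_unit :: "'u set \<Rightarrow> ('u, 'u) module \<Rightarrow> 'u \<Rightarrow> ('u \<Rightarrow> 'u)" where
  "product_unit J S s = (\<lambda>j\<in>J. s)"

definition product_module_functor :: "'u set \<Rightarrow> ('u, 'u \<Rightarrow> 'u) mod_functor" where
  "product_module_functor J = underlying_module_functor (product_functor J) (product_unit J)"

definition sum_module_functor :: "'u set \<Rightarrow> ('u, 'u \<Rightarrow> 'u) mod_functor" where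
  "sum_module_functor J =
     \<lparr>obj = (\<lambda>S. (obj (product_module_functor J) S)
        \<lparr>carrier := {x \<in> J \<rightarrow>\<^sub>E carrier S. finite {j \<in> J. x j \<noteq> \<zero>\<^bsub>S\<^esub>}}\<rparr>),
      arr = arr (product_module_functor J)\<rparr>"

text \<open>The action of the product functor on itself and on the direct sum.\<close>

definition product_act ::
  "'u set \<Rightarrow> ('u, 'u) module \<Rightarrow> ('u \<Rightarrow> 'u) \<Rightarrow> ('u \<Rightarrow> 'u) \<Rightarrow> ('u \<Rightarrow> 'u)" where
  "product_act J S = mult (obj (product_functor J) S)"

text \<open>
  The inclusions are injective morphisms \<open>i\<close> and \<open>p\<close> of functors of modules over the product
  functor; the module structure \<open>act\<close> extends the given one by compatibility with
  \<^const>\<open>product_unit\<close>.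
\<close>

definition in_family_F ::
  "'n itself \<Rightarrow> ('u, 'x) ring_scheme \<Rightarrow> ('u, 'm) mod_functor \<Rightarrow> bool" where
  "in_family_F n R M \<longleftrightarrow>
     is_dual_functor n R M \<and>
     (\<exists>(J :: 'u set) act i p.
        algebra_module_functor R (product_functor J) (product_unit J) M act \<and>
        algebra_module_morphism R (product_functor J)
          (sum_module_functor J) (product_act J) M act i \<and>
        algebra_module_morphism R (product_functor J)
          M act (product_module_functor J) (product_act J) p \<and>
        (\<forall>S. algebra R S \<longrightarrow>
           inj_on (i S) (carrier (obj (sum_module_functor J) S)) \<and>
           inj_on (p S) (carrier (obj M S)) \<and>
           (\<forall>x\<in>carrier (obj (sum_module_functor J) S). p S (i S x) = x)))"

end

theory Submission
  imports "HOL-Algebra.Free_Abelian_Groups" "HOL-Algebra.Weak_Morphisms"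
    "HOL-Algebra.Multiplicative_Group" Defs
begin

text \<open>
  The defect \<open>f(a m) - a f(m)\<close> is bilinear in \<open>a\<close> and \<open>m\<close> and natural in the algebra. Since \<open>M'\<close> embeds
  into a product of copies of the scalar functor, \<open>f\<close> is equivariant as soon as every coordinate of
  the defect vanishes, and such a coordinate is a bilinear form on \<open>A \<times> M\<close> with values in the scalar
  functor. By hypothesis it vanishes over \<open>R\<close>. The theorem therefore follows from a statement about
  two functors in the family: a bilinear form on them that vanishes over \<open>R\<close> is zero
  (\<open>bilinear_form_determined\<close>).

  The reason is a density property. A functor \<open>M\<close> of the family contains a direct sum of copies of
  the scalar functor, and a functional on \<open>M\<close>, over any algebra \<open>S\<close>, is determined by its values on the
  unit vectors of this direct sum (\<open>functional_on_intermediate_determined\<close>). As these unit vectors are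
  defined over \<open>R\<close>, the bilinear form vanishes on pairs of them, hence everywhere by applying
  density in each argument.

  Density reduces to the case \<open>M = \<Prod>\<^sub>J R\<close> by restricting a functional to the orbits of the
  action of \<open>\<Prod>\<^sub>J R\<close> on \<open>M\<close>. For the product it is the fact that a natural functional depends
  on finitely many coordinates (\<open>functional_on_product_determined\<close>): its value at a generic vector
  lies in a ring whose elements involve only finitely many of the generic coordinates. A square-zero
  extension of \<open>S\<close> provides such generic coordinates.
\<close>

section \<open>Algebras along a ring homomorphism\<close>

lemma cring_cong:
  fixes T :: "('a, 'y) ring_scheme" and T' :: "('a, 'z) ring_scheme"
  assumes T: "cring T" and [simp]: "carrier T' = carrier T" "mult T' = mult T" "one T' = one T"
    "\<zero>\<^bsub>T'\<^esub> = \<zero>\<^bsub>T\<^esub>" "add T' = add T"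
  shows "cring T'"
proof -
  interpret T: cring T by (rule T)
  show ?thesis
  proof (rule cringI)
    show "abelian_group T'"
      by (rule abelian_groupI) (auto simp: T.a_ac intro: T.l_neg)
    show "comm_monoid T'"
      by (rule comm_monoidI) (auto simp: T.m_ac)
  qed (auto simp: T.l_distr)
qed

text \<open>
  \<open>R\<close> itself is an \<open>R\<close>-algebra, so it is one of the test algebras; being initial, it maps to
  all the others (\<open>structure_algebra_hom\<close> below).
\<close>

lemma algebra_self_algebra: "cring R \<Longrightarrow> algebra R (self_algebra R)"
proof -
  assume "cring R"
  then interpret cring R .
  have "cring (self_algebra R)"
    by (rule cring_cong[OF \<open>cring R\<close>]) (simp_all add: self_algebra_def)
  then show ?thesis
    by (rule algebraI[OF \<open>cring R\<close>]) (auto simp: self_algebra_def l_distr r_distr m_assoc)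
qed

lemma algebra_hom_closed: "h \<in> algebra_hom R S T \<Longrightarrow> x \<in> carrier S \<Longrightarrow> h x \<in> carrier T"
  by (auto simp: algebra_hom_def ring_hom_closed)

lemma id_algebra_hom: "algebra R S \<Longrightarrow> (\<lambda>s\<in>carrier S. s) \<in> algebra_hom R S S"
proof -
  assume "algebra R S"
  then interpret algebra R S .
  show ?thesis by (auto simp: algebra_hom_def intro!: ring_hom_memI)
qed

lemma compose_id_right:
  assumes "\<eta> \<in> algebra_hom R S T"
  shows "compose (carrier S) \<eta> (\<lambda>s\<in>carrier S. s) = \<eta>"
  using assms by (auto simp: algebra_hom_def compose_def extensional_def fun_eq_iff)

lemma structure_algebra_hom:
  assumes "algebra R S"
  shows "(\<lambda>r\<in>carrier R. r \<odot>\<^bsub>S\<^esub> \<one>\<^bsub>S\<^esub>) \<in> algebra_hom R (self_algebra R) S"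
proof -
  interpret algebra R S by fact
  show ?thesis
    by (auto simp: algebra_hom_def self_algebra_def smult_l_distr smult_assoc1 smult_assoc2
        intro!: ring_hom_memI)
qed

text \<open>
  An \<open>R\<close>-algebra structure on a ring \<open>T\<close> that receives an \<open>R\<close>-algebra \<open>S\<close> through a ring
  homomorphism \<open>\<eta>\<close>: the only one that makes \<open>\<eta>\<close> linear.
\<close>

definition algebra_along ::
  "('u, 'u) module \<Rightarrow> 'u ring \<Rightarrow> ('u \<Rightarrow> 'u) \<Rightarrow> ('u, 'u) module" where
  "algebra_along S T \<eta> =
     \<lparr>carrier = carrier T, mult = mult T, one = one T, zero = \<zero>\<^bsub>T\<^esub>, add = add T,
      smult = (\<lambda>r x. \<eta> (r \<odot>\<^bsub>S\<^esub> \<one>\<^bsub>S\<^esub>) \<otimes>\<^bsub>T\<^esub> x)\<rparr>"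

text \<open>
  Linearity over \<open>R\<close> is automatic under \<open>S\<close>: a ring endomorphism of \<open>T\<close> that fixes the image of
  \<open>S\<close> commutes with scalars, because these act by multiplication with elements of that image.
\<close>

lemma algebra_along:
  assumes "algebra R S" "cring T" "\<eta> \<in> ring_hom S T"
  defines "T' \<equiv> algebra_along S T \<eta>"
  shows "algebra R T'"
    and "restrict \<eta> (carrier S) \<in> algebra_hom R S T'"
    and "\<lbrakk>\<psi> \<in> ring_hom T T; \<And>s. s \<in> carrier S \<Longrightarrow> \<psi> (\<eta> s) = \<eta> s\<rbrakk>
      \<Longrightarrow> restrict \<psi> (carrier T) \<in> algebra_hom R T' T'"
proof -
  interpret S: algebra R S by fact
  interpret T: cring T by fact
  have \<eta>: "\<eta> x \<in> carrier T" if "x \<in> carrier S" for x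
    using assms(3) that by (rule ring_hom_closed)
  have r1: "r \<odot>\<^bsub>S\<^esub> \<one>\<^bsub>S\<^esub> \<in> carrier S" if "r \<in> carrier R" for r using that by simp
  have "cring T'"
    by (rule cring_cong[OF \<open>cring T\<close>]) (simp_all add: T'_def algebra_along_def)
  have mul1: "(a \<otimes>\<^bsub>R\<^esub> b) \<odot>\<^bsub>S\<^esub> \<one>\<^bsub>S\<^esub> = (a \<odot>\<^bsub>S\<^esub> \<one>\<^bsub>S\<^esub>) \<otimes>\<^bsub>S\<^esub> (b \<odot>\<^bsub>S\<^esub> \<one>\<^bsub>S\<^esub>)"
    if "a \<in> carrier R" "b \<in> carrier R" for a b
    using that by (simp add: S.smult_assoc1 S.smult_assoc2)
  show "algebra R T'"
  proof (rule algebraI[OF S.R_cring \<open>cring T'\<close>])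
    fix a b x assume "a \<in> carrier R" "b \<in> carrier R" "x \<in> carrier T'"
    then show "(a \<oplus>\<^bsub>R\<^esub> b) \<odot>\<^bsub>T'\<^esub> x = a \<odot>\<^bsub>T'\<^esub> x \<oplus>\<^bsub>T'\<^esub> b \<odot>\<^bsub>T'\<^esub> x"
      by (simp add: T'_def algebra_along_def S.smult_l_distr ring_hom_add[OF assms(3)] \<eta> r1 T.l_distr)
    show "(a \<otimes>\<^bsub>R\<^esub> b) \<odot>\<^bsub>T'\<^esub> x = a \<odot>\<^bsub>T'\<^esub> (b \<odot>\<^bsub>T'\<^esub> x)"
      using \<open>a \<in> carrier R\<close> \<open>b \<in> carrier R\<close> \<open>x \<in> carrier T'\<close>
      by (simp add: T'_def algebra_along_def mul1 ring_hom_mult[OF assms(3)] \<eta> r1 T.m_assoc)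
  qed (auto simp: T'_def algebra_along_def \<eta> T.r_distr T.m_assoc ring_hom_one[OF assms(3)])
  show "restrict \<eta> (carrier S) \<in> algebra_hom R S T'"
  proof -
    have "\<eta> (r \<odot>\<^bsub>S\<^esub> \<one>\<^bsub>S\<^esub>) \<otimes>\<^bsub>T\<^esub> \<eta> x = \<eta> (r \<odot>\<^bsub>S\<^esub> x)" if "r \<in> carrier R" "x \<in> carrier S" for r x
    proof -
      have "r \<odot>\<^bsub>S\<^esub> x = (r \<odot>\<^bsub>S\<^esub> \<one>\<^bsub>S\<^esub>) \<otimes>\<^bsub>S\<^esub> x"
        using that by (simp add: S.smult_assoc2)
      then show ?thesis
        using ring_hom_mult[OF assms(3) r1[OF that(1)] that(2)] by simp
    qed
    then show ?thesis
      using assms(3) by (auto simp: T'_def algebra_along_def algebra_hom_def \<eta> ring_hom_mult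
          ring_hom_add ring_hom_one intro!: ring_hom_memI)
  qed
  show "restrict \<psi> (carrier T) \<in> algebra_hom R T' T'"
    if "\<psi> \<in> ring_hom T T" "\<And>s. s \<in> carrier S \<Longrightarrow> \<psi> (\<eta> s) = \<eta> s"
    using that by (auto simp: T'_def algebra_along_def algebra_hom_def \<eta> ring_hom_closed
        ring_hom_mult ring_hom_add ring_hom_one intro!: ring_hom_memI)
qed

section \<open>A generic null extension inside the universe\<close>

text \<open>
  The square-zero extension \<open>S \<oplus> S\<^sup>(\<^sup>I\<^sup>)\<close>, generated over \<open>S\<close> by elements \<open>\<epsilon>\<^sub>i\<close> with \<open>\<epsilon>\<^sub>i \<epsilon>\<^sub>j = 0\<close>.
  It replaces the polynomial ring in the proof that a linear functional on a product has finite
  support: a pair \<open>(r, c)\<close> stands for \<open>r + \<Sum>\<^sub>i c\<^sub>i \<epsilon>\<^sub>i\<close>, and only finitely many \<open>c\<^sub>i\<close> are nonzero.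
\<close>

definition null_extension :: "('b, 'z) ring_scheme \<Rightarrow> ('b \<times> ('i \<Rightarrow> 'b)) ring" where
  "null_extension S =
     \<lparr>carrier = carrier S \<times> {c. range c \<subseteq> carrier S \<and> finite {j. c j \<noteq> \<zero>\<^bsub>S\<^esub>}},
      mult = (\<lambda>(r, c) (r', c'). (r \<otimes>\<^bsub>S\<^esub> r', \<lambda>j. r \<otimes>\<^bsub>S\<^esub> c' j \<oplus>\<^bsub>S\<^esub> r' \<otimes>\<^bsub>S\<^esub> c j)),
      one = (\<one>\<^bsub>S\<^esub>, \<lambda>_. \<zero>\<^bsub>S\<^esub>),
      zero = (\<zero>\<^bsub>S\<^esub>, \<lambda>_. \<zero>\<^bsub>S\<^esub>),
      add = (\<lambda>(r, c) (r', c'). (r \<oplus>\<^bsub>S\<^esub> r', \<lambda>j. c j \<oplus>\<^bsub>S\<^esub> c' j))\<rparr>"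

lemma cring_null_extension:
  assumes "cring S"
  shows "cring (null_extension S :: ('b \<times> ('i \<Rightarrow> 'b)) ring)"
proof -
  interpret S: cring S by fact
  let ?T = "null_extension S :: ('b \<times> ('i \<Rightarrow> 'b)) ring"
  have fin: "finite {j :: 'i. g (c j) (c' j) \<noteq> \<zero>\<^bsub>S\<^esub>}"
    if "finite {j. c j \<noteq> \<zero>\<^bsub>S\<^esub>}" "finite {j. c' j \<noteq> \<zero>\<^bsub>S\<^esub>}" "g \<zero>\<^bsub>S\<^esub> \<zero>\<^bsub>S\<^esub> = \<zero>\<^bsub>S\<^esub>" for c c' :: "'i \<Rightarrow> 'b" and g
    by (rule finite_subset[OF _ finite_UnI[OF that(1,2)]]) (use that(3) in force)
  have c: "c j \<in> carrier S" if "range c \<subseteq> carrier S" for c :: "'i \<Rightarrow> 'b" and j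
    using that by blast
  show ?thesis
  proof (rule cringI)
    show "abelian_group ?T"
    proof (rule abelian_groupI)
      fix x y assume "x \<in> carrier ?T" "y \<in> carrier ?T"
      then show "x \<oplus>\<^bsub>?T\<^esub> y \<in> carrier ?T"
        by (auto simp: null_extension_def c intro!: fin[where g = "\<lambda>x y. x \<oplus>\<^bsub>S\<^esub> y"])
    next
      fix x assume "x \<in> carrier ?T"
      then show "\<exists>y\<in>carrier ?T. y \<oplus>\<^bsub>?T\<^esub> x = \<zero>\<^bsub>?T\<^esub>"
        by (intro bexI[of _ "(\<ominus>\<^bsub>S\<^esub> fst x, \<lambda>j. \<ominus>\<^bsub>S\<^esub> snd x j)"])
          (auto simp: null_extension_def c S.l_neg intro!: fin[where g = "\<lambda>x y. \<ominus>\<^bsub>S\<^esub> x" and c' = "snd x"])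
    qed (auto simp: null_extension_def c S.a_ac)
    show "comm_monoid ?T"
    proof (rule comm_monoidI)
      fix x y assume xy: "x \<in> carrier ?T" "y \<in> carrier ?T"
      obtain r u r' u' where eq: "x = (r, u)" "y = (r', u')" by (cases x, cases y)
      show "x \<otimes>\<^bsub>?T\<^esub> y \<in> carrier ?T"
        using xy fin[of u u' "\<lambda>a b. r \<otimes>\<^bsub>S\<^esub> b \<oplus>\<^bsub>S\<^esub> r' \<otimes>\<^bsub>S\<^esub> a"]
        by (auto simp: eq null_extension_def c)
      show "x \<otimes>\<^bsub>?T\<^esub> y = y \<otimes>\<^bsub>?T\<^esub> x"
        using xy by (auto simp: null_extension_def c S.m_comm S.a_comm)
    qed (auto simp: null_extension_def c S.r_distr S.m_ac S.a_ac)
  qed (auto simp: null_extension_def c S.l_distr S.r_distr S.a_ac)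
qed

text \<open>
  Test algebras must have their carriers in \<open>'u\<close>. For infinite \<open>'u\<close> the null extension fits, since a
  finitely supported function is given by its finite graph and an infinite set is as large as its
  square and as the set of its finite subsets.
\<close>

lemma null_extension_inject_universe:
  fixes S :: "('u, 'z) ring_scheme"
  assumes "infinite (UNIV :: 'u set)"
  shows "\<exists>enc :: 'u \<times> ('u \<Rightarrow> 'u) \<Rightarrow> 'u. inj_on enc (carrier (null_extension S))"
proof -
  have sq: "(UNIV :: ('u \<times> 'u) set) \<approx> (UNIV :: 'u set)"
    using card_of_Times_same_infinite[OF assms] by (simp add: eqpoll_iff_card_of_ordIso)
  have "{c :: 'u \<Rightarrow> 'u. finite {j. c j \<noteq> \<zero>\<^bsub>S\<^esub>}} \<lesssim> Fpow (UNIV :: ('u \<times> 'u) set)"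
    using lepoll_restricted_funspace[of "UNIV :: 'u set" "UNIV :: 'u set" "\<lambda>_. \<zero>\<^bsub>S\<^esub>"] by simp
  also have "\<dots> \<approx> (UNIV :: ('u \<times> 'u) set)"
    using assms by (intro eqpoll_Fpow) (simp add: finite_prod)
  also note sq
  finally have "{c :: 'u \<Rightarrow> 'u. finite {j. c j \<noteq> \<zero>\<^bsub>S\<^esub>}} \<lesssim> (UNIV :: 'u set)" .
  then have "(UNIV :: 'u set) \<times> {c :: 'u \<Rightarrow> 'u. finite {j. c j \<noteq> \<zero>\<^bsub>S\<^esub>}} \<lesssim> (UNIV :: 'u set) \<times> (UNIV :: 'u set)"
    by (rule times_lepoll_mono[OF lepoll_refl])
  also have "\<dots> \<approx> (UNIV :: 'u set)" using sq by simp
  finally obtain enc :: "'u \<times> ('u \<Rightarrow> 'u) \<Rightarrow> 'u"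
    where "inj_on enc (UNIV \<times> {c. finite {j. c j \<noteq> \<zero>\<^bsub>S\<^esub>}})"
    unfolding lepoll_def by blast
  then have "inj_on enc (carrier (null_extension S))"
    by (rule inj_on_subset) (auto simp: null_extension_def)
  then show ?thesis by blast
qed

text \<open>
  The \<open>S\<close>-linear substitution \<open>\<epsilon>\<^sub>j \<mapsto> a\<^sub>j \<epsilon>\<^sub>k\<close> for a fixed index \<open>k\<close>.
\<close>

definition collapse :: "('b, 'z) ring_scheme \<Rightarrow> 'i \<Rightarrow> ('i \<Rightarrow> 'b) \<Rightarrow> 'b \<times> ('i \<Rightarrow> 'b) \<Rightarrow> 'b \<times> ('i \<Rightarrow> 'b)" where
  "collapse S k a = (\<lambda>(r, c). (r, \<lambda>j. if j = k then finsum S (\<lambda>j. a j \<otimes>\<^bsub>S\<^esub> c j) {j. c j \<noteq> \<zero>\<^bsub>S\<^esub>} else \<zero>\<^bsub>S\<^esub>))"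

text \<open>
  All products of generators vanish on both sides, so a linear map between the square-zero parts
  is multiplicative. Linearity of the sum of the \<open>a\<^sub>j c\<^sub>j\<close> is seen by letting the sums for two
  elements range over the union of their supports.
\<close>

lemma collapse_ring_hom:
  fixes S :: "('b, 'z) ring_scheme" and k :: 'i
  assumes "cring S" "range a \<subseteq> carrier S"
  shows "collapse S k a \<in> ring_hom (null_extension S) (null_extension S)"
proof -
  interpret S: cring S by fact
  let ?N = "null_extension S :: ('b \<times> ('i \<Rightarrow> 'b)) ring"
  let ?\<Sigma> = "\<lambda>c F. finsum S (\<lambda>j. a j \<otimes>\<^bsub>S\<^esub> c j) F"
  let ?supp = "\<lambda>c. {j. c j \<noteq> \<zero>\<^bsub>S\<^esub>}"
  have a: "a j \<in> carrier S" for j using assms(2) by blast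
  have c: "c j \<in> carrier S" if "range c \<subseteq> carrier S" for c :: "'i \<Rightarrow> 'b" and j
    using that by blast
  have enlarge: "?\<Sigma> c (?supp c) = ?\<Sigma> c F"
    if "range c \<subseteq> carrier S" "finite F" "?supp c \<subseteq> F" for c F
    using that(2,3) c[OF that(1)] by (intro S.add.finprod_mono_neutral_cong_left) (auto simp: a)
  have closed: "?\<Sigma> c (?supp c) \<in> carrier S" if "range c \<subseteq> carrier S" for c
    using c[OF that] a by (intro S.finsum_closed) auto
  have lin: "?\<Sigma> (\<lambda>j. r \<otimes>\<^bsub>S\<^esub> c j \<oplus>\<^bsub>S\<^esub> r' \<otimes>\<^bsub>S\<^esub> c' j) (?supp (\<lambda>j. r \<otimes>\<^bsub>S\<^esub> c j \<oplus>\<^bsub>S\<^esub> r' \<otimes>\<^bsub>S\<^esub> c' j))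
      = r \<otimes>\<^bsub>S\<^esub> ?\<Sigma> c (?supp c) \<oplus>\<^bsub>S\<^esub> r' \<otimes>\<^bsub>S\<^esub> ?\<Sigma> c' (?supp c')"
    if "r \<in> carrier S" "r' \<in> carrier S" "range c \<subseteq> carrier S" "range c' \<subseteq> carrier S"
      "finite (?supp c)" "finite (?supp c')" for r r' c c'
  proof -
    note cc = c[OF that(3)] c[OF that(4)]
    let ?F = "?supp c \<union> ?supp c'"
    have "?\<Sigma> (\<lambda>j. r \<otimes>\<^bsub>S\<^esub> c j \<oplus>\<^bsub>S\<^esub> r' \<otimes>\<^bsub>S\<^esub> c' j) (?supp (\<lambda>j. r \<otimes>\<^bsub>S\<^esub> c j \<oplus>\<^bsub>S\<^esub> r' \<otimes>\<^bsub>S\<^esub> c' j))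
        = ?\<Sigma> (\<lambda>j. r \<otimes>\<^bsub>S\<^esub> c j \<oplus>\<^bsub>S\<^esub> r' \<otimes>\<^bsub>S\<^esub> c' j) ?F"
      using that cc by (intro enlarge) auto
    also have "\<dots> = finsum S (\<lambda>j. r \<otimes>\<^bsub>S\<^esub> (a j \<otimes>\<^bsub>S\<^esub> c j) \<oplus>\<^bsub>S\<^esub> r' \<otimes>\<^bsub>S\<^esub> (a j \<otimes>\<^bsub>S\<^esub> c' j)) ?F"
      using that(1,2) a cc by (intro S.finsum_cong') (auto simp: S.r_distr S.m_lcomm)
    also have "\<dots> = r \<otimes>\<^bsub>S\<^esub> ?\<Sigma> c ?F \<oplus>\<^bsub>S\<^esub> r' \<otimes>\<^bsub>S\<^esub> ?\<Sigma> c' ?F"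
      using that a cc by (simp add: S.finsum_addf S.finsum_rdistr Pi_def)
    also have "?\<Sigma> c ?F = ?\<Sigma> c (?supp c)" by (rule enlarge[symmetric]) (use that in auto)
    also have "?\<Sigma> c' ?F = ?\<Sigma> c' (?supp c')" by (rule enlarge[symmetric]) (use that in auto)
    finally show ?thesis .
  qed
  show ?thesis
  proof (rule ring_hom_memI)
    fix x assume "x \<in> carrier ?N"
    then show "collapse S k a x \<in> carrier ?N"
      by (auto simp: null_extension_def collapse_def closed)
  next
    fix x y assume "x \<in> carrier ?N" "y \<in> carrier ?N"
    then obtain r c r' c' where xy: "x = (r, c)" "y = (r', c')" and
      r: "r \<in> carrier S" "r' \<in> carrier S" "range c \<subseteq> carrier S" "range c' \<subseteq> carrier S"
      "finite (?supp c)" "finite (?supp c')"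
      by (auto simp: null_extension_def)
    show "collapse S k a (x \<otimes>\<^bsub>?N\<^esub> y) = collapse S k a x \<otimes>\<^bsub>?N\<^esub> collapse S k a y"
      \<comment> \<open>The square-zero part of \<open>(r, c) (r', c')\<close> is \<open>r c' + r' c\<close>.\<close>
      using lin[of r r' c' c] r by (auto simp: xy null_extension_def collapse_def fun_eq_iff)
    show "collapse S k a (x \<oplus>\<^bsub>?N\<^esub> y) = collapse S k a x \<oplus>\<^bsub>?N\<^esub> collapse S k a y"
      using lin[of "\<one>\<^bsub>S\<^esub>" "\<one>\<^bsub>S\<^esub>" c c'] r
      by (auto simp: xy null_extension_def collapse_def fun_eq_iff closed c)
  qed (auto simp: null_extension_def collapse_def fun_eq_iff)
qed

text \<open>
  The sum ranges over the support of the generator \<open>\<epsilon>\<^sub>j\<close>, which is \<open>{j}\<close> except over the zero ring,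
  where it is empty.
\<close>

lemma collapse_unit:
  assumes "cring S" "range a \<subseteq> carrier S"
  shows "collapse S k a (\<zero>\<^bsub>S\<^esub>, \<lambda>i. if i = j then \<one>\<^bsub>S\<^esub> else \<zero>\<^bsub>S\<^esub>) =
    (\<zero>\<^bsub>S\<^esub>, \<lambda>i. if i = k then a j else \<zero>\<^bsub>S\<^esub>)"
proof -
  interpret S: cring S by fact
  have a: "a j \<in> carrier S" for j using assms(2) by blast
  show ?thesis
  proof (cases "\<one>\<^bsub>S\<^esub> = \<zero>\<^bsub>S\<^esub>")
    case True
    then have "a j = \<zero>\<^bsub>S\<^esub>" using a[of j] S.one_zeroD by auto
    with True show ?thesis by (simp add: collapse_def fun_eq_iff)
  next
    case False
    then have "{i. (if i = j then \<one>\<^bsub>S\<^esub> else \<zero>\<^bsub>S\<^esub>) \<noteq> \<zero>\<^bsub>S\<^esub>} = {j}" by auto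
    then show ?thesis by (simp add: collapse_def fun_eq_iff a)
  qed
qed

text \<open>
  What is needed of the null extension, after moving it into \<open>'u\<close>: generators \<open>\<epsilon>\<^sub>j\<close> and an element
  \<open>\<delta>\<close> that detects elements of \<open>S\<close>, such that for every \<open>t\<close> the substitutions \<open>\<epsilon>\<^sub>j \<mapsto> a\<^sub>j \<delta>\<close> all give
  the same value at \<open>t\<close>, as long as \<open>a\<close> vanishes on the finitely many indices that occur in \<open>t\<close>.
  That common value is the component of \<open>t\<close> in \<open>S\<close>.
\<close>

lemma generic_null_algebra:
  fixes S :: "('u, 'u) module"
  assumes RS: "algebra R S" and inf: "infinite (UNIV :: 'u set)"
  obtains T :: "('u, 'u) module" and \<eta> \<epsilon> \<delta> where
    "algebra R T" "\<eta> \<in> algebra_hom R S T" "\<And>j. \<epsilon> (j :: 'u) \<in> carrier T" "\<delta> \<in> carrier T"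
    "\<And>s. \<lbrakk>s \<in> carrier S; \<eta> s \<otimes>\<^bsub>T\<^esub> \<delta> = \<zero>\<^bsub>T\<^esub>\<rbrakk> \<Longrightarrow> s = \<zero>\<^bsub>S\<^esub>"
    "\<And>t. t \<in> carrier T \<Longrightarrow> \<exists>F r. finite F \<and>
       (\<forall>a. range a \<subseteq> carrier S \<longrightarrow> (\<forall>j\<in>F. a j = \<zero>\<^bsub>S\<^esub>) \<longrightarrow>
         (\<exists>\<psi>\<in>algebra_hom R T T. compose (carrier S) \<psi> \<eta> = \<eta> \<and>
            (\<forall>j. \<psi> (\<epsilon> j) = \<eta> (a j) \<otimes>\<^bsub>T\<^esub> \<delta>) \<and> \<psi> t = r))"
proof -
  interpret S: algebra R S by fact
  define N where "N = (null_extension S :: ('u \<times> ('u \<Rightarrow> 'u)) ring)"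
  have crN: "cring N" unfolding N_def by (rule cring_null_extension[OF S.M_cring])
  interpret N: cring N by fact
  obtain enc :: "'u \<times> ('u \<Rightarrow> 'u) \<Rightarrow> 'u" where inj: "inj_on enc (carrier N)"
    using null_extension_inject_universe[OF inf, of S] by (auto simp: N_def)
  define T0 where "T0 = image_ring enc N"
  have iso: "enc \<in> ring_iso N T0" unfolding T0_def by (rule inj_imp_image_ring_iso[OF inj])
  then have hom: "enc \<in> ring_hom N T0" by (simp add: ring_iso_def)
  have z0: "\<zero>\<^bsub>T0\<^esub> = enc \<zero>\<^bsub>N\<^esub>" by (simp add: T0_def image_ring_zero)
  have car: "carrier T0 = enc ` carrier N" by (simp add: T0_def image_ring_carrier)
  have crT: "cring T0"
    using N.ring_iso_imp_img_cring[OF iso] by (simp add: z0[symmetric])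
  define d where "d = inv_into (carrier N) enc"
  have d: "d (enc x) = x" if "x \<in> carrier N" for x
    using inj that by (simp add: d_def)
  have "d \<in> ring_iso T0 N"
    unfolding d_def by (rule ring_iso_set_sym[OF N.ring_axioms iso])
  then have dhom: "d \<in> ring_hom T0 N" by (simp add: ring_iso_def)
  define \<eta>0 where "\<eta>0 s = enc (s, \<lambda>_. \<zero>\<^bsub>S\<^esub>)" for s
  have N0: "(s, \<lambda>_. \<zero>\<^bsub>S\<^esub>) \<in> carrier N" if "s \<in> carrier S" for s
    using that by (auto simp: N_def null_extension_def)
  have N1: "(\<zero>\<^bsub>S\<^esub>, \<lambda>i. if i = j then s else \<zero>\<^bsub>S\<^esub>) \<in> carrier N" if "s \<in> carrier S" for s j
    using that by (auto simp: N_def null_extension_def)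
  have "(\<lambda>s. (s, \<lambda>_. \<zero>\<^bsub>S\<^esub>)) \<in> ring_hom S N"
    by (rule ring_hom_memI) (auto simp: N_def null_extension_def)
  from ring_hom_trans[OF this hom] have \<eta>0: "\<eta>0 \<in> ring_hom S T0"
    by (simp add: \<eta>0_def[abs_def] comp_def)
  \<comment> \<open>Any index serves as the target of the substitutions.\<close>
  define k :: 'u where "k = undefined"
  define \<epsilon> where "\<epsilon> j = enc (\<zero>\<^bsub>S\<^esub>, \<lambda>i. if i = j then \<one>\<^bsub>S\<^esub> else \<zero>\<^bsub>S\<^esub>)" for j
  define \<delta> where "\<delta> = \<epsilon> k"
  define \<eta> where "\<eta> = restrict \<eta>0 (carrier S)"
  define T where "T = algebra_along S T0 \<eta>0"
  have Tsimps: "carrier T = carrier T0" "mult T = mult T0" "\<zero>\<^bsub>T\<^esub> = \<zero>\<^bsub>T0\<^esub>"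
    by (simp_all add: T_def algebra_along_def)
  have scale: "\<eta> s \<otimes>\<^bsub>T\<^esub> \<delta> = enc (\<zero>\<^bsub>S\<^esub>, \<lambda>i. if i = k then s else \<zero>\<^bsub>S\<^esub>)" if "s \<in> carrier S" for s
  proof -
    have "\<eta> s \<otimes>\<^bsub>T\<^esub> \<delta> = enc ((s, \<lambda>_. \<zero>\<^bsub>S\<^esub>) \<otimes>\<^bsub>N\<^esub> (\<zero>\<^bsub>S\<^esub>, \<lambda>i. if i = k then \<one>\<^bsub>S\<^esub> else \<zero>\<^bsub>S\<^esub>))"
      using that by (simp add: Tsimps \<eta>_def \<eta>0_def \<delta>_def \<epsilon>_def ring_hom_mult[OF hom] N0 N1)
    also have "(s, \<lambda>_. \<zero>\<^bsub>S\<^esub>) \<otimes>\<^bsub>N\<^esub> (\<zero>\<^bsub>S\<^esub>, \<lambda>i. if i = k then \<one>\<^bsub>S\<^esub> else \<zero>\<^bsub>S\<^esub>)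
        = (\<zero>\<^bsub>S\<^esub>, \<lambda>i. if i = k then s else \<zero>\<^bsub>S\<^esub>)"
      using that by (auto simp: N_def null_extension_def fun_eq_iff)
    finally show ?thesis .
  qed
  show thesis
  proof (rule that)
    show "algebra R T" "\<eta> \<in> algebra_hom R S T"
      unfolding T_def \<eta>_def by (fact algebra_along[OF RS crT \<eta>0])+
    show "\<epsilon> j \<in> carrier T" for j by (simp add: Tsimps car \<epsilon>_def N1)
    show "\<delta> \<in> carrier T" by (simp add: Tsimps car \<delta>_def \<epsilon>_def N1)
  next
    fix s assume s: "s \<in> carrier S" "\<eta> s \<otimes>\<^bsub>T\<^esub> \<delta> = \<zero>\<^bsub>T\<^esub>"
    then have "enc (\<zero>\<^bsub>S\<^esub>, \<lambda>i. if i = k then s else \<zero>\<^bsub>S\<^esub>) = enc \<zero>\<^bsub>N\<^esub>"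
      using scale[OF s(1)] by (simp add: Tsimps(3) z0)
    then have "(\<zero>\<^bsub>S\<^esub>, \<lambda>i. if i = k then s else \<zero>\<^bsub>S\<^esub>) = \<zero>\<^bsub>N\<^esub>"
      by (rule inj_onD[OF inj]) (simp_all add: N1 s)
    then show "s = \<zero>\<^bsub>S\<^esub>"
      by (auto simp: N_def null_extension_def fun_eq_iff split: if_splits)
  next
    fix t assume "t \<in> carrier T"
    then obtain r c where rc: "(r, c) \<in> carrier N" and t: "t = enc (r, c)"
      by (auto simp: Tsimps car)
    then have r: "r \<in> carrier S" and c: "range c \<subseteq> carrier S" "finite {j. c j \<noteq> \<zero>\<^bsub>S\<^esub>}"
      by (auto simp: N_def null_extension_def)
    have cc: "c j \<in> carrier S" for j using c(1) by blast
    show "\<exists>F r. finite F \<and>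
       (\<forall>a. range a \<subseteq> carrier S \<longrightarrow> (\<forall>j\<in>F. a j = \<zero>\<^bsub>S\<^esub>) \<longrightarrow>
         (\<exists>\<psi>\<in>algebra_hom R T T. compose (carrier S) \<psi> \<eta> = \<eta> \<and>
            (\<forall>j. \<psi> (\<epsilon> j) = \<eta> (a j) \<otimes>\<^bsub>T\<^esub> \<delta>) \<and> \<psi> t = r))"
    proof (intro exI conjI allI impI)
      show "finite {j. c j \<noteq> \<zero>\<^bsub>S\<^esub>}" by fact
      fix a :: "'u \<Rightarrow> 'u" assume a: "range a \<subseteq> carrier S" and ac: "\<forall>j\<in>{j. c j \<noteq> \<zero>\<^bsub>S\<^esub>}. a j = \<zero>\<^bsub>S\<^esub>"
      define \<psi>0 where "\<psi>0 = enc \<circ> (collapse S k a \<circ> d)"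
      have \<psi>0: "\<psi>0 \<in> ring_hom T0 T0"
        unfolding \<psi>0_def
        by (intro ring_hom_trans[OF _ hom] ring_hom_trans[OF dhom])
          (use collapse_ring_hom[OF S.M_cring a] in \<open>simp add: N_def\<close>)
      have \<psi>0_enc: "\<psi>0 (enc x) = enc (collapse S k a x)" if "x \<in> carrier N" for x
        using that by (simp add: \<psi>0_def d)
      have fix_\<eta>: "\<psi>0 (\<eta>0 s) = \<eta>0 s" if "s \<in> carrier S" for s
      proof -
        have "collapse S k a (s, \<lambda>_. \<zero>\<^bsub>S\<^esub>) = (s, \<lambda>_. \<zero>\<^bsub>S\<^esub>)"
          by (simp add: collapse_def fun_eq_iff)
        then show ?thesis using that by (simp add: \<eta>0_def \<psi>0_enc N0)
      qed
      show "\<exists>\<psi>\<in>algebra_hom R T T. compose (carrier S) \<psi> \<eta> = \<eta> \<and>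
            (\<forall>j. \<psi> (\<epsilon> j) = \<eta> (a j) \<otimes>\<^bsub>T\<^esub> \<delta>) \<and> \<psi> t = \<eta> r"
      proof (intro bexI conjI allI)
        show "restrict \<psi>0 (carrier T0) \<in> algebra_hom R T T"
          unfolding T_def by (rule algebra_along(3)[OF RS crT \<eta>0 \<psi>0 fix_\<eta>])
        show "compose (carrier S) (restrict \<psi>0 (carrier T0)) \<eta> = \<eta>"
          by (auto simp: compose_def \<eta>_def fun_eq_iff fix_\<eta> ring_hom_closed[OF \<eta>0])
        show "restrict \<psi>0 (carrier T0) (\<epsilon> j) = \<eta> (a j) \<otimes>\<^bsub>T\<^esub> \<delta>" for j
        proof -
          have "a j \<in> carrier S" using a by blast
          then show ?thesis
            by (simp add: scale \<epsilon>_def car N1 \<psi>0_enc collapse_unit[OF S.M_cring a])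
        qed
        have "finsum S (\<lambda>j. a j \<otimes>\<^bsub>S\<^esub> c j) {j. c j \<noteq> \<zero>\<^bsub>S\<^esub>} = \<zero>\<^bsub>S\<^esub>"
          using ac cc by (intro S.add.finprod_one_eqI) (auto simp: cc)
        then have "collapse S k a (r, c) = (r, \<lambda>_. \<zero>\<^bsub>S\<^esub>)"
          by (simp add: collapse_def fun_eq_iff)
        then show "restrict \<psi>0 (carrier T0) t = \<eta> r"
          using r rc by (simp add: t car \<psi>0_enc \<eta>_def \<eta>0_def)
      qed
    qed
  qed
qed

section \<open>Linear functionals over an algebra\<close>

text \<open>
  The elements of \<open>M\<^sup>*(S)\<close>, described by pairs of an \<open>R\<close>-algebra \<open>T\<close> and a homomorphism
  \<open>\<eta> : S \<rightarrow> T\<close> instead of by \<open>S\<close>-algebras. With this description \<open>S\<close> itself is the pair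
  \<open>(S, id)\<close>, whereas restricting the \<open>S\<close>-algebra \<open>S\<close> to \<open>R\<close> yields a record that may differ from \<open>S\<close>
  in the scalar multiplication outside the carrier of \<open>R\<close>.
\<close>

locale functional_over =
  fixes R :: "('u, 'x) ring_scheme" and S :: "('u, 'u) module" and M :: "('u, 'm) mod_functor"
    and h :: "('u, 'u) module \<Rightarrow> ('u \<Rightarrow> 'u) \<Rightarrow> 'm \<Rightarrow> 'u"
  assumes closed: "\<lbrakk>algebra R T; \<eta> \<in> algebra_hom R S T; x \<in> carrier (obj M T)\<rbrakk>
      \<Longrightarrow> h T \<eta> x \<in> carrier T"
    and additive: "\<lbrakk>algebra R T; \<eta> \<in> algebra_hom R S T; x \<in> carrier (obj M T); y \<in> carrier (obj M T)\<rbrakk>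
      \<Longrightarrow> h T \<eta> (x \<oplus>\<^bsub>obj M T\<^esub> y) = h T \<eta> x \<oplus>\<^bsub>T\<^esub> h T \<eta> y"
    and homogeneous: "\<lbrakk>algebra R T; \<eta> \<in> algebra_hom R S T; t \<in> carrier T; x \<in> carrier (obj M T)\<rbrakk>
      \<Longrightarrow> h T \<eta> (t \<odot>\<^bsub>obj M T\<^esub> x) = t \<otimes>\<^bsub>T\<^esub> h T \<eta> x"
    and natural: "\<lbrakk>algebra R T; algebra R U; \<eta> \<in> algebra_hom R S T; k \<in> algebra_hom R T U;
        x \<in> carrier (obj M T)\<rbrakk>
      \<Longrightarrow> h U (compose (carrier S) k \<eta>) (arr M T U k x) = k (h T \<eta> x)"

lemma product_module_functor_simps:
  "carrier (obj (product_module_functor J) T) = J \<rightarrow>\<^sub>E carrier T"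
  "x \<oplus>\<^bsub>obj (product_module_functor J) T\<^esub> y = (\<lambda>j\<in>J. x j \<oplus>\<^bsub>T\<^esub> y j)"
  "t \<odot>\<^bsub>obj (product_module_functor J) T\<^esub> x = (\<lambda>j\<in>J. t \<otimes>\<^bsub>T\<^esub> x j)"
  "arr (product_module_functor J) T U k x = (\<lambda>j\<in>J. k (x j))"
  by (auto simp: product_module_functor_def underlying_module_functor_def product_functor_def
      product_unit_def fun_eq_iff)

definition unit_vector :: "'u set \<Rightarrow> ('u, 'u) module \<Rightarrow> 'u \<Rightarrow> ('u \<Rightarrow> 'u)" where
  "unit_vector J T k = (\<lambda>j\<in>J. if j = k then \<one>\<^bsub>T\<^esub> else \<zero>\<^bsub>T\<^esub>)"

text \<open>
  An element with finite support is a finite linear combination of unit vectors. The support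
  bound \<open>F\<close> may stick out of \<open>J\<close>, which keeps the induction over finite sets free of side conditions.
\<close>

lemma functional_finite_support:
  assumes "algebra R S" and fo: "functional_over R S (product_module_functor J) \<phi>"
    and unit: "\<And>k. k \<in> J \<Longrightarrow> \<phi> S (\<lambda>s\<in>carrier S. s) (unit_vector J S k) = \<zero>\<^bsub>S\<^esub>"
    and "finite F" and "a \<in> J \<rightarrow>\<^sub>E carrier S" and "\<And>j. j \<in> J - F \<Longrightarrow> a j = \<zero>\<^bsub>S\<^esub>"
  shows "\<phi> S (\<lambda>s\<in>carrier S. s) a = \<zero>\<^bsub>S\<^esub>"
  using assms(4-)
proof (induction F arbitrary: a rule: finite_induct)
  interpret S: algebra R S by fact
  interpret functional_over R S "product_module_functor J" \<phi> by fact
  note id = \<open>algebra R S\<close> id_algebra_hom[OF \<open>algebra R S\<close>]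
  note P = product_module_functor_simps
  {
    case empty
    have "a = \<zero>\<^bsub>S\<^esub> \<odot>\<^bsub>obj (product_module_functor J) S\<^esub> a"
      using empty by (auto simp: P fun_eq_iff PiE_def extensional_def)
    then have "\<phi> S (\<lambda>s\<in>carrier S. s) a
        = \<phi> S (\<lambda>s\<in>carrier S. s) (\<zero>\<^bsub>S\<^esub> \<odot>\<^bsub>obj (product_module_functor J) S\<^esub> a)"
      by (rule arg_cong)
    also have "\<dots> = \<zero>\<^bsub>S\<^esub> \<otimes>\<^bsub>S\<^esub> \<phi> S (\<lambda>s\<in>carrier S. s) a"
      using homogeneous[OF id S.zero_closed, of a] empty(1) by (simp add: P(1))
    also have "\<dots> = \<zero>\<^bsub>S\<^esub>"
      using closed[OF id, of a] empty(1) by (simp add: P(1))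
    finally show ?case .
  next
    case (insert k F)
    show ?case
    proof (cases "k \<in> J")
      case False
      then show ?thesis by (intro insert.IH insert.prems(1)) (use insert.prems(2) in auto)
    next
      case True
      have aj: "a j \<in> carrier S" if "j \<in> J" for j using insert.prems(1) that by blast
      define b where "b = (\<lambda>j\<in>J. if j = k then \<zero>\<^bsub>S\<^esub> else a j)"
      have b: "b \<in> J \<rightarrow>\<^sub>E carrier S" by (auto simp: b_def aj)
      have u: "unit_vector J S k \<in> J \<rightarrow>\<^sub>E carrier S" by (auto simp: unit_vector_def)
      let ?au = "a k \<odot>\<^bsub>obj (product_module_functor J) S\<^esub> unit_vector J S k"
      have au: "?au \<in> J \<rightarrow>\<^sub>E carrier S" by (auto simp: P unit_vector_def aj True)
      have "a = b \<oplus>\<^bsub>obj (product_module_functor J) S\<^esub> ?au"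
        using insert.prems(1) by (auto simp: P fun_eq_iff b_def unit_vector_def aj True PiE_def extensional_def)
      then have "\<phi> S (\<lambda>s\<in>carrier S. s) a
          = \<phi> S (\<lambda>s\<in>carrier S. s) b \<oplus>\<^bsub>S\<^esub> \<phi> S (\<lambda>s\<in>carrier S. s) ?au"
        using additive[OF id, of b ?au] b au by (simp add: P(1))
      also have "\<phi> S (\<lambda>s\<in>carrier S. s) b = \<zero>\<^bsub>S\<^esub>"
        by (rule insert.IH[OF b]) (use insert.prems(2) in \<open>auto simp: b_def\<close>)
      also have "\<phi> S (\<lambda>s\<in>carrier S. s) ?au = \<zero>\<^bsub>S\<^esub>"
        using homogeneous[OF id aj[OF True], of "unit_vector J S k"] u by (simp add: P(1) unit[OF True] aj[OF True])
      finally show ?thesis by simp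
    qed
  }
qed

text \<open>
  The dual of \<open>\<Prod>\<^sub>J R\<close> is \<open>\<Oplus>\<^sub>J R\<close>. Over the generic null extension the
  functional takes some value \<open>t\<close> at the generic vector \<open>(\<epsilon>\<^sub>j)\<^sub>j\<close>, and \<open>t\<close> involves only a finite set
  \<open>F\<close> of the \<open>\<epsilon>\<^sub>j\<close>. Substituting \<open>b\<^sub>j \<delta>\<close> for \<open>\<epsilon>\<^sub>j\<close> turns the generic vector into \<open>\<delta> b\<close>, where by
  linearity the value is \<open>\<delta> \<phi>(b)\<close>. If \<open>b\<close> vanishes on \<open>F\<close>, this value does not depend on \<open>b\<close>, so it is
  the value for \<open>b = 0\<close>, which is \<open>0\<close>; as \<open>\<delta>\<close> detects elements of \<open>S\<close>, \<open>\<phi>(b) = 0\<close>. The remaining finitely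
  many coordinates are covered by the unit vectors. A finite universe may be too small for
  the null extension, but then \<open>J\<close> is finite and unit vectors suffice.
\<close>

lemma functional_on_product_determined:
  fixes S :: "('u, 'u) module"
  assumes RS: "algebra R S" and fo: "functional_over R S (product_module_functor J) \<phi>"
    and unit: "\<And>k. k \<in> J \<Longrightarrow> \<phi> S (\<lambda>s\<in>carrier S. s) (unit_vector J S k) = \<zero>\<^bsub>S\<^esub>"
    and a: "a \<in> J \<rightarrow>\<^sub>E carrier S"
  shows "\<phi> S (\<lambda>s\<in>carrier S. s) a = \<zero>\<^bsub>S\<^esub>"
proof (cases "finite (UNIV :: 'u set)")
  case True
  then have "finite J" by (rule finite_subset[OF subset_UNIV])
  show ?thesis by (rule functional_finite_support[OF RS fo unit \<open>finite J\<close> a]) simp_all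
next
  case False
  interpret S: algebra R S by fact
  interpret functional_over R S "product_module_functor J" \<phi> by fact
  let ?P = "product_module_functor J" and ?id = "\<lambda>s\<in>carrier S. s"
  note id = RS id_algebra_hom[OF RS]
  note P = product_module_functor_simps
  obtain T :: "('u, 'u) module" and \<eta> \<epsilon> \<delta> where RT: "algebra R T"
    and \<eta>: "\<eta> \<in> algebra_hom R S T" and \<epsilon>: "\<And>j. \<epsilon> (j :: 'u) \<in> carrier T" and \<delta>: "\<delta> \<in> carrier T"
    and faithful: "\<And>s. \<lbrakk>s \<in> carrier S; \<eta> s \<otimes>\<^bsub>T\<^esub> \<delta> = \<zero>\<^bsub>T\<^esub>\<rbrakk> \<Longrightarrow> s = \<zero>\<^bsub>S\<^esub>"
    and collapsing: "\<And>t. t \<in> carrier T \<Longrightarrow> \<exists>F r. finite F \<and>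
       (\<forall>a. range a \<subseteq> carrier S \<longrightarrow> (\<forall>j\<in>F. a j = \<zero>\<^bsub>S\<^esub>) \<longrightarrow>
         (\<exists>\<psi>\<in>algebra_hom R T T. compose (carrier S) \<psi> \<eta> = \<eta> \<and>
            (\<forall>j. \<psi> (\<epsilon> j) = \<eta> (a j) \<otimes>\<^bsub>T\<^esub> \<delta>) \<and> \<psi> t = r))"
    by (rule generic_null_algebra[OF RS False]) (rule that)
  interpret T: algebra R T by fact
  \<comment> \<open>The generic vector.\<close>
  define x where "x = (\<lambda>j\<in>J. \<epsilon> j)"
  have x: "x \<in> carrier (obj ?P T)" by (simp add: x_def P \<epsilon>)
  obtain F r where F: "finite F"
    and \<psi>: "\<And>a. \<lbrakk>range a \<subseteq> carrier S; \<forall>j\<in>F. a j = \<zero>\<^bsub>S\<^esub>\<rbrakk> \<Longrightarrow>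
      \<exists>\<psi>\<in>algebra_hom R T T. compose (carrier S) \<psi> \<eta> = \<eta> \<and>
        (\<forall>j. \<psi> (\<epsilon> j) = \<eta> (a j) \<otimes>\<^bsub>T\<^esub> \<delta>) \<and> \<psi> (\<phi> T \<eta> x) = r"
    using collapsing[OF closed[OF RT \<eta> x]] by blast
  have const: "\<eta> (\<phi> S ?id b) \<otimes>\<^bsub>T\<^esub> \<delta> = r" if b: "b \<in> J \<rightarrow>\<^sub>E carrier S" and bF: "\<forall>j\<in>J \<inter> F. b j = \<zero>\<^bsub>S\<^esub>" for b
  proof -
    \<comment> \<open>The substitution is indexed by the whole universe, so \<open>b\<close> is extended by zero.\<close>
    let ?b = "\<lambda>j. if j \<in> J then b j else \<zero>\<^bsub>S\<^esub>"
    have "range ?b \<subseteq> carrier S" "\<forall>j\<in>F. ?b j = \<zero>\<^bsub>S\<^esub>" using b bF by auto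
    then obtain \<psi> where \<psi>h: "\<psi> \<in> algebra_hom R T T" and fix\<eta>: "compose (carrier S) \<psi> \<eta> = \<eta>"
      and \<psi>\<epsilon>: "\<And>j. \<psi> (\<epsilon> j) = \<eta> (?b j) \<otimes>\<^bsub>T\<^esub> \<delta>" and \<psi>r: "\<psi> (\<phi> T \<eta> x) = r"
      using \<psi>[of ?b] by blast
    have \<eta>b: "arr ?P S T \<eta> b \<in> carrier (obj ?P T)"
      using b by (auto simp: P intro!: algebra_hom_closed[OF \<eta>])
    have "r = \<phi> T \<eta> (arr ?P T T \<psi> x)"
      using natural[OF RT RT \<eta> \<psi>h x] by (simp add: fix\<eta> \<psi>r)
    also have "arr ?P T T \<psi> x = \<delta> \<odot>\<^bsub>obj ?P T\<^esub> arr ?P S T \<eta> b"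
      using b by (auto simp: P x_def \<psi>\<epsilon> fun_eq_iff T.m_comm \<delta> intro!: T.m_comm algebra_hom_closed[OF \<eta>])
    also have "\<phi> T \<eta> \<dots> = \<delta> \<otimes>\<^bsub>T\<^esub> \<phi> T \<eta> (arr ?P S T \<eta> b)"
      by (rule homogeneous[OF RT \<eta> \<delta> \<eta>b])
    also have "\<phi> T \<eta> (arr ?P S T \<eta> b) = \<eta> (\<phi> S ?id b)"
      using natural[OF RS RT id(2) \<eta>, of b] b by (simp add: P(1) compose_id_right[OF \<eta>])
    finally show ?thesis
      using closed[OF id, of b] b \<delta> by (simp add: P(1) T.m_comm algebra_hom_closed[OF \<eta>])
  qed
  have zero: "\<phi> S ?id (\<lambda>j\<in>J. \<zero>\<^bsub>S\<^esub>) = \<zero>\<^bsub>S\<^esub>"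
    by (rule functional_finite_support[OF RS fo unit, of "{}"]) auto
  have \<eta>0: "\<eta> \<zero>\<^bsub>S\<^esub> = \<zero>\<^bsub>T\<^esub>"
    using \<eta> by (intro ring_hom_zero[OF _ cring.axioms(1)[OF S.M_cring] cring.axioms(1)[OF T.M_cring]]) (simp add: algebra_hom_def)
  have "r = \<zero>\<^bsub>T\<^esub>"
    using const[of "\<lambda>j\<in>J. \<zero>\<^bsub>S\<^esub>"] \<delta> by (simp add: zero \<eta>0)
  \<comment> \<open>The argument above covers \<open>b\<close>, finite support covers \<open>c\<close>, and \<open>a = b + c\<close>.\<close>
  define b where "b = (\<lambda>j\<in>J. if j \<in> F then \<zero>\<^bsub>S\<^esub> else a j)"
  define c where "c = (\<lambda>j\<in>J. if j \<in> F then a j else \<zero>\<^bsub>S\<^esub>)"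
  have bc: "b \<in> J \<rightarrow>\<^sub>E carrier S" "c \<in> J \<rightarrow>\<^sub>E carrier S" using a by (auto simp: b_def c_def)
  have "\<phi> S ?id b \<in> carrier S" using closed[OF id, of b] bc by (simp add: P(1))
  then have "\<phi> S ?id b = \<zero>\<^bsub>S\<^esub>"
    by (rule faithful) (use const[OF bc(1)] \<open>r = \<zero>\<^bsub>T\<^esub>\<close> in \<open>simp add: b_def\<close>)
  moreover have "\<phi> S ?id c = \<zero>\<^bsub>S\<^esub>"
    by (rule functional_finite_support[OF RS fo unit F bc(2)]) (auto simp: c_def)
  moreover have "a = b \<oplus>\<^bsub>obj ?P S\<^esub> c"
    using a by (auto simp: P b_def c_def fun_eq_iff PiE_def Pi_def extensional_def)
  ultimately show ?thesis
    using additive[OF id, of b c] bc by (simp add: P(1))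
qed

section \<open>Functors between a direct sum and a product\<close>

text \<open>
  The direct sum is dense in every functor of the family. Given \<open>m\<close>, pull the functional \<open>h\<close> back
  along the orbit map \<open>b \<mapsto> b m\<close> from the product: on a unit vector \<open>e\<^sub>k\<close> it gives
  \<open>h(e\<^sub>k m) = m\<^sub>k h(e\<^sub>k)\<close>, which is zero, because \<open>e\<^sub>k m\<close> already lies in the direct sum. So it is zero
  on the product, in particular at the unit, where its value is \<open>h(m)\<close>.
\<close>

lemma functional_on_intermediate_determined:
  assumes "algebra_module_functor R (product_functor J) (product_unit J) M act"
    and i: "algebra_module_morphism R (product_functor J)
          (sum_module_functor J) (product_act J) M act i"
    and p: "algebra_module_morphism R (product_functor J)
          M act (product_module_functor J) (product_act J) p"
    and inj: "inj_on (p S) (carrier (obj M S))"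
    and pi: "\<And>x. x \<in> carrier (obj (sum_module_functor J) S) \<Longrightarrow> p S (i S x) = x"
    and RS: "algebra R S" and "functional_over R S M h"
    and zero: "\<And>k. k \<in> J \<Longrightarrow> h S (\<lambda>s\<in>carrier S. s) (i S (unit_vector J S k)) = \<zero>\<^bsub>S\<^esub>"
    and m: "m \<in> carrier (obj M S)"
  shows "h S (\<lambda>s\<in>carrier S. s) m = \<zero>\<^bsub>S\<^esub>"
proof -
  interpret S: algebra R S by fact
  interpret algebra_module_functor R "product_functor J" "product_unit J" M act by fact
  interpret h: functional_over R S M h by fact
  let ?A = "product_functor J" and ?P = "product_module_functor J" and ?id = "\<lambda>s\<in>carrier S. s"
  note id = RS id_algebra_hom[OF RS]
  note P = product_module_functor_simps
  have A: "carrier (obj ?A T) = J \<rightarrow>\<^sub>E carrier T"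
    "x \<oplus>\<^bsub>obj ?A T\<^esub> y = x \<oplus>\<^bsub>obj ?P T\<^esub> y"
    "product_unit J T t \<otimes>\<^bsub>obj ?A T\<^esub> x = t \<odot>\<^bsub>obj ?P T\<^esub> x"
    "arr ?A T U k x = arr ?P T U k x" for T U k x y t
    by (simp_all add: product_functor_def product_module_functor_def underlying_module_functor_def)
  have unit_closed: "product_unit J T t \<in> carrier (obj ?A T)" if "t \<in> carrier T" for T t
    using that by (auto simp: A product_unit_def)
  note actL = left_module.act_closed[OF left_module_obj] left_module.act_l_distr[OF left_module_obj]
    left_module.act_assoc[OF left_module_obj]
  define \<phi> where "\<phi> T \<eta> b = h T \<eta> (act T b (arr M S T \<eta> m))" for T \<eta> b
  have "functional_over R S ?P \<phi>"
  proof
    fix T \<eta> x assume T: "algebra R T" "\<eta> \<in> algebra_hom R S T" and x: "x \<in> carrier (obj ?P T)"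
    have x': "x \<in> carrier (obj ?A T)" using x by (simp add: A P(1))
    have m': "arr M S T \<eta> m \<in> carrier (obj M T)" by (rule M.arr_closed[OF RS T m])
    show "\<phi> T \<eta> x \<in> carrier T"
      using T x' m' by (simp add: \<phi>_def h.closed actL)
    show "\<phi> T \<eta> (x \<oplus>\<^bsub>obj ?P T\<^esub> y) = \<phi> T \<eta> x \<oplus>\<^bsub>T\<^esub> \<phi> T \<eta> y" if "y \<in> carrier (obj ?P T)" for y
      using T x' m' that by (simp add: \<phi>_def h.additive actL A(2)[symmetric]) (simp add: A(1) P(1) h.additive actL)
    show "\<phi> T \<eta> (t \<odot>\<^bsub>obj ?P T\<^esub> x) = t \<otimes>\<^bsub>T\<^esub> \<phi> T \<eta> x" if t: "t \<in> carrier T" for t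
      using T x' m' t by (simp add: \<phi>_def A(3)[symmetric] actL unit_closed act_compatible h.homogeneous)
    show "\<phi> U (compose (carrier S) k \<eta>) (arr ?P T U k x) = k (\<phi> T \<eta> x)"
      if U: "algebra R U" and k: "k \<in> algebra_hom R T U" for U k
    proof -
      have "arr M S U (compose (carrier S) k \<eta>) m = arr M T U k (arr M S T \<eta> m)"
        by (rule M.arr_comp[OF RS T(1) U T(2) k m])
      then show ?thesis
        using T x' m' U k
        by (simp add: \<phi>_def A(4)[symmetric] act_natural[symmetric] h.natural actL)
    qed
  qed
  moreover have "\<phi> S ?id (unit_vector J S k) = \<zero>\<^bsub>S\<^esub>" if k: "k \<in> J" for k
  proof -
    let ?e = "unit_vector J S k"
    have "p S \<in> left_module_hom (obj ?A S) (obj M S) (act S) (obj ?P S) (product_act J S)"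
      using p RS by (simp add: algebra_module_morphism_def)
    then have p': "p S x \<in> J \<rightarrow>\<^sub>E carrier S" "p S (act S a x) = product_act J S a (p S x)"
      if "x \<in> carrier (obj M S)" "a \<in> carrier (obj ?A S)" for a x
      using that unfolding left_module_hom_def P(1) by blast+
    have eA: "?e \<in> carrier (obj ?A S)" by (auto simp: A unit_vector_def)
    have pm: "p S m \<in> J \<rightarrow>\<^sub>E carrier S" using p'(1)[OF m eA] .
    then have pmk: "p S m k \<in> carrier S" using k by blast
    have "{j \<in> J. ?e j \<noteq> \<zero>\<^bsub>S\<^esub>} \<subseteq> {k}" by (auto simp: unit_vector_def)
    then have e: "?e \<in> carrier (obj (sum_module_functor J) S)"
      using eA by (simp add: sum_module_functor_def A finite_subset)
    then have ie: "i S ?e \<in> carrier (obj M S)"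
      using i RS by (auto simp: algebra_module_morphism_def left_module_hom_def)
    \<comment> \<open>Both sides agree in the product, into which \<open>M\<close> embeds.\<close>
    have "act S ?e m = act S (product_unit J S (p S m k)) (i S ?e)"
    proof (rule inj_onD[OF inj])
      show "p S (act S ?e m) = p S (act S (product_unit J S (p S m k)) (i S ?e))"
        unfolding p'(2)[OF m eA] p'(2)[OF ie unit_closed[OF pmk]] pi[OF e]
        using pmk k PiE_mem[OF pm] by (auto simp: product_act_def product_functor_def product_unit_def unit_vector_def fun_eq_iff)
    qed (use RS m ie eA unit_closed[OF pmk] in \<open>simp_all add: actL\<close>)
    also have "\<dots> = p S m k \<odot>\<^bsub>obj M S\<^esub> i S ?e" by (rule act_compatible[OF RS pmk ie])
    finally show ?thesis
      using h.homogeneous[OF id pmk ie] by (simp add: \<phi>_def M.arr_id[OF RS m] zero[OF k] pmk)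
  qed
  ultimately have "\<phi> S ?id (\<lambda>j\<in>J. \<one>\<^bsub>S\<^esub>) = \<zero>\<^bsub>S\<^esub>"
    by (rule functional_on_product_determined[OF RS]) auto
  moreover have "act S (\<lambda>j\<in>J. \<one>\<^bsub>S\<^esub>) m = m"
    using left_module.act_one[OF left_module_obj[OF RS] m] by (simp add: product_functor_def)
  ultimately show ?thesis by (simp add: \<phi>_def M.arr_id[OF RS m])
qed

text \<open>
  All that is used about the inclusion of a direct sum: \<open>e T k\<close> is the image of the \<open>k\<close>-th unit
  vector over \<open>T\<close>. These elements come from the base ring, and they detect functionals over every
  algebra.
\<close>

locale determining_family =
  fixes R :: "('u, 'x) ring_scheme" and M :: "('u, 'm) mod_functor"
    and J :: "'u set" and e :: "('u, 'u) module \<Rightarrow> 'u \<Rightarrow> 'm"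
  assumes family_closed: "\<lbrakk>algebra R T; k \<in> J\<rbrakk> \<Longrightarrow> e T k \<in> carrier (obj M T)"
    and family_natural: "\<lbrakk>algebra R S; algebra R T; \<eta> \<in> algebra_hom R S T; k \<in> J\<rbrakk>
       \<Longrightarrow> arr M S T \<eta> (e S k) = e T k"
    and family_determines: "\<lbrakk>algebra R S; functional_over R S M h;
        \<And>k. k \<in> J \<Longrightarrow> h S (\<lambda>s\<in>carrier S. s) (e S k) = \<zero>\<^bsub>S\<^esub>; m \<in> carrier (obj M S)\<rbrakk>
       \<Longrightarrow> h S (\<lambda>s\<in>carrier S. s) m = \<zero>\<^bsub>S\<^esub>"

lemma in_family_F_determining_family:
  fixes M :: "('u, 'm) mod_functor"
  assumes "in_family_F n R M"
  shows "\<exists>J e. determining_family R M J e"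
proof -
  from assms obtain J :: "'u set" and act i p where
    amf: "algebra_module_functor R (product_functor J) (product_unit J) M act" and
    i: "algebra_module_morphism R (product_functor J)
          (sum_module_functor J) (product_act J) M act i" and
    p: "algebra_module_morphism R (product_functor J)
          M act (product_module_functor J) (product_act J) p" and
    inj: "\<And>S. algebra R S \<Longrightarrow> inj_on (p S) (carrier (obj M S))" and
    pi: "\<And>S x. \<lbrakk>algebra R S; x \<in> carrier (obj (sum_module_functor J) S)\<rbrakk> \<Longrightarrow> p S (i S x) = x"
    unfolding in_family_F_def by blast
  have e: "unit_vector J T k \<in> carrier (obj (sum_module_functor J) T)" if "algebra R T" for T k
  proof -
    interpret algebra R T by fact
    have "{j \<in> J. unit_vector J T k j \<noteq> \<zero>\<^bsub>T\<^esub>} \<subseteq> {k}" by (auto simp: unit_vector_def)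
    then show ?thesis
      by (auto simp: sum_module_functor_def unit_vector_def intro: finite_subset)
  qed
  have "determining_family R M J (\<lambda>T k. i T (unit_vector J T k))"
  proof
    show "i T (unit_vector J T k) \<in> carrier (obj M T)" if "algebra R T" for T k
      using i e[OF that] that by (auto simp: algebra_module_morphism_def natural_transformation_def)
    show "arr M S T h (i S (unit_vector J S k)) = i T (unit_vector J T k)"
      if ST: "algebra R S" "algebra R T" and h: "h \<in> algebra_hom R S T" for S T h k
    proof -
      interpret S: algebra R S by fact
      interpret T: algebra R T by fact
      have hr: "h \<in> ring_hom S T" using h by (simp add: algebra_hom_def)
      have "arr (sum_module_functor J) S T h (unit_vector J S k) = unit_vector J T k"
        using ring_hom_one[OF hr] ring_hom_zero[OF hr cring.axioms(1)[OF S.M_cring] cring.axioms(1)[OF T.M_cring]]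
        by (auto simp: sum_module_functor_def product_module_functor_simps unit_vector_def fun_eq_iff)
      moreover have "i T (arr (sum_module_functor J) S T h (unit_vector J S k))
          = arr M S T h (i S (unit_vector J S k))"
        using i ST h e[OF ST(1)] by (simp add: algebra_module_morphism_def natural_transformation_def)
      ultimately show ?thesis by simp
    qed
    show "h S (\<lambda>s\<in>carrier S. s) m = \<zero>\<^bsub>S\<^esub>"
      if "algebra R S" "functional_over R S M h" "m \<in> carrier (obj M S)"
        "\<And>k. k \<in> J \<Longrightarrow> h S (\<lambda>s\<in>carrier S. s) (i S (unit_vector J S k)) = \<zero>\<^bsub>S\<^esub>" for S h m
      by (rule functional_on_intermediate_determined[OF amf i p inj[OF that(1)] pi[OF that(1)]
            that(1,2,4,3)])
  qed
  then show ?thesis by blast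
qed

text \<open>
  The inclusion into a product is the way in which a target functor enters the proof: equalities
  in it may be tested coordinate by coordinate.
\<close>

lemma in_family_F_coordinates:
  assumes "in_family_F n R M"
  obtains J p where "module_morphism R M (product_module_functor J) p"
    "\<And>S. algebra R S \<Longrightarrow> inj_on (p S) (carrier (obj M S))"
proof -
  from assms obtain J act p where
    amf: "algebra_module_functor R (product_functor J) (product_unit J) M act" and
    p: "algebra_module_morphism R (product_functor J)
          M act (product_module_functor J) (product_act J) p" and
    inj: "\<And>S. algebra R S \<Longrightarrow> inj_on (p S) (carrier (obj M S))"
    unfolding in_family_F_def by blast
  interpret algebra_module_functor R "product_functor J" "product_unit J" M act by (fact amf)
  have "p S (s \<odot>\<^bsub>obj M S\<^esub> x) = s \<odot>\<^bsub>obj (product_module_functor J) S\<^esub> p S x"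
    if "algebra R S" "s \<in> carrier S" "x \<in> carrier (obj M S)" for S s x
  proof -
    have "product_unit J S s \<in> carrier (obj (product_functor J) S)"
      using that by (auto simp: product_functor_def product_unit_def)
    then have "p S (act S (product_unit J S s) x) = product_act J S (product_unit J S s) (p S x)"
      using p that by (simp add: algebra_module_morphism_def left_module_hom_def)
    then show ?thesis
      using act_compatible[OF that]
      by (simp add: product_act_def product_module_functor_def underlying_module_functor_def)
  qed
  then have "module_morphism R M (product_module_functor J) p"
    using p by (auto simp: algebra_module_morphism_def module_morphism_def left_module_hom_def)
  with inj show thesis using that by blast
qed

section \<open>Bilinear forms and the equivariance defect\<close>

locale bilinear_form =
  fixes R :: "('u, 'x) ring_scheme" and X :: "('u, 'a) mod_functor" and M :: "('u, 'm) mod_functor"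
    and g :: "('u, 'u) module \<Rightarrow> 'a \<Rightarrow> 'm \<Rightarrow> 'u"
  assumes form_closed: "\<lbrakk>algebra R T; a \<in> carrier (obj X T); m \<in> carrier (obj M T)\<rbrakk>
      \<Longrightarrow> g T a m \<in> carrier T"
    and add_left: "\<lbrakk>algebra R T; a \<in> carrier (obj X T); b \<in> carrier (obj X T); m \<in> carrier (obj M T)\<rbrakk>
      \<Longrightarrow> g T (a \<oplus>\<^bsub>obj X T\<^esub> b) m = g T a m \<oplus>\<^bsub>T\<^esub> g T b m"
    and add_right: "\<lbrakk>algebra R T; a \<in> carrier (obj X T); m \<in> carrier (obj M T); n \<in> carrier (obj M T)\<rbrakk>
      \<Longrightarrow> g T a (m \<oplus>\<^bsub>obj M T\<^esub> n) = g T a m \<oplus>\<^bsub>T\<^esub> g T a n"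
    and smult_left: "\<lbrakk>algebra R T; t \<in> carrier T; a \<in> carrier (obj X T); m \<in> carrier (obj M T)\<rbrakk>
      \<Longrightarrow> g T (t \<odot>\<^bsub>obj X T\<^esub> a) m = t \<otimes>\<^bsub>T\<^esub> g T a m"
    and smult_right: "\<lbrakk>algebra R T; t \<in> carrier T; a \<in> carrier (obj X T); m \<in> carrier (obj M T)\<rbrakk>
      \<Longrightarrow> g T a (t \<odot>\<^bsub>obj M T\<^esub> m) = t \<otimes>\<^bsub>T\<^esub> g T a m"
    and form_natural: "\<lbrakk>algebra R T; algebra R U; k \<in> algebra_hom R T U;
        a \<in> carrier (obj X T); m \<in> carrier (obj M T)\<rbrakk>
      \<Longrightarrow> g U (arr X T U k a) (arr M T U k m) = k (g T a m)"

text \<open>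
  Fixing an element over \<open>S\<close> in one argument and carrying it along to all algebras under \<open>S\<close> turns
  a bilinear form into a functional over \<open>S\<close>.
\<close>

lemma (in bilinear_form) functional_left:
  assumes "module_functor R M" "algebra R S" "m \<in> carrier (obj M S)"
  shows "functional_over R S X (\<lambda>T \<eta> a. g T a (arr M S T \<eta> m))"
proof -
  interpret M: module_functor R M by fact
  show ?thesis
    using assms(2,3) by unfold_locales
      (simp_all add: M.arr_closed form_closed add_left smult_left form_natural[symmetric] M.arr_comp)
qed

lemma (in bilinear_form) functional_right:
  assumes "module_functor R X" "algebra R S" "a \<in> carrier (obj X S)"
  shows "functional_over R S M (\<lambda>T \<eta> m. g T (arr X S T \<eta> a) m)"
proof -
  interpret X: module_functor R X by fact
  show ?thesis
    using assms(2,3) by unfold_locales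
      (simp_all add: X.arr_closed form_closed add_right smult_right form_natural[symmetric] X.arr_comp)
qed

text \<open>
  A bilinear form that vanishes over \<open>R\<close> vanishes on pairs of unit vectors over every algebra,
  since these are images of unit vectors over \<open>R\<close>. Density in the second argument and
  then in the first argument extends the vanishing to all pairs.
\<close>

lemma bilinear_form_determined:
  assumes R: "cring R" and X: "in_family_F nx R X" and M: "in_family_F nm R M"
    and "bilinear_form R X M g"
    and base: "\<And>a m. \<lbrakk>a \<in> carrier (obj X (self_algebra R)); m \<in> carrier (obj M (self_algebra R))\<rbrakk>
      \<Longrightarrow> g (self_algebra R) a m = \<zero>\<^bsub>R\<^esub>"
    and S: "algebra R S" and a: "a \<in> carrier (obj X S)" and m: "m \<in> carrier (obj M S)"
  shows "g S a m = \<zero>\<^bsub>S\<^esub>"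
proof -
  interpret bilinear_form R X M g by fact
  interpret S: algebra R S by fact
  interpret X: module_functor R X using X by (simp add: in_family_F_def is_dual_functor_def)
  interpret M: module_functor R M using M by (simp add: in_family_F_def is_dual_functor_def)
  obtain I d where "determining_family R X I d"
    using in_family_F_determining_family[OF X] by blast
  then interpret d: determining_family R X I d .
  obtain J e where "determining_family R M J e"
    using in_family_F_determining_family[OF M] by blast
  then interpret e: determining_family R M J e .
  have generators: "g S (d S i) (e S j) = \<zero>\<^bsub>S\<^esub>" if ij: "i \<in> I" "j \<in> J" for i j
  proof -
    let ?R = "self_algebra R" and ?u = "\<lambda>r\<in>carrier R. r \<odot>\<^bsub>S\<^esub> \<one>\<^bsub>S\<^esub>"
    note RR = algebra_self_algebra[OF R]
    note u = structure_algebra_hom[OF S]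
    have "g S (d S i) (e S j) = ?u (g ?R (d ?R i) (e ?R j))"
      using form_natural[OF RR S u d.family_closed[OF RR ij(1)] e.family_closed[OF RR ij(2)]]
      by (simp only: d.family_natural[OF RR S u ij(1)] e.family_natural[OF RR S u ij(2)])
    also have "\<dots> = \<zero>\<^bsub>S\<^esub>"
      by (simp add: base d.family_closed[OF RR ij(1)] e.family_closed[OF RR ij(2)])
    finally show ?thesis .
  qed
  have left: "g S (d S i) m = \<zero>\<^bsub>S\<^esub>" if i: "i \<in> I" for i
    using e.family_determines[OF S functional_right[OF X.module_functor_axioms S d.family_closed[OF S i]] _ m] i
    by (simp add: X.arr_id[OF S d.family_closed[OF S i]] generators)
  show ?thesis
    using d.family_determines[OF S functional_left[OF M.module_functor_axioms S m] _ a]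
    by (simp add: M.arr_id[OF S m] left)
qed

lemma module_morphism_closed:
  "\<lbrakk>module_morphism R M N f; algebra R S; x \<in> carrier (obj M S)\<rbrakk> \<Longrightarrow> f S x \<in> carrier (obj N S)"
  by (auto simp: module_morphism_def natural_transformation_def)

lemma module_morphism_compose:
  assumes "module_morphism R M N f" "module_morphism R N P g"
  shows "module_morphism R M P (\<lambda>S x. g S (f S x))"
  using assms unfolding module_morphism_def natural_transformation_def by (auto simp: Pi_iff)

lemma coordinate_functional:
  assumes "module_morphism R M (product_module_functor J) p" and j: "j \<in> J"
  shows "module_morphism R M scalar_functor (\<lambda>S x. p S x j)"
  using assms by (fastforce simp: module_morphism_def natural_transformation_def
      product_module_functor_simps scalar_functor_def self_algebra_def)

text \<open>
  Scalars come out of \<open>a\<close> because the action on \<open>M\<close> extends the scalar multiplication, and out of \<open>m\<close>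
  because, in addition, they are central in \<open>A\<close>.
\<close>

lemma bilinear_form_action:
  assumes "algebra_module_functor R A \<iota> M act" and l: "module_morphism R M scalar_functor l"
  shows "bilinear_form R (underlying_module_functor A \<iota>) M (\<lambda>T a m. l T (act T a m))"
proof -
  interpret algebra_module_functor R A \<iota> M act by fact
  have l': "l T x \<in> carrier T" "l T (x \<oplus>\<^bsub>obj M T\<^esub> y) = l T x \<oplus>\<^bsub>T\<^esub> l T y"
    "t \<in> carrier T \<Longrightarrow> l T (t \<odot>\<^bsub>obj M T\<^esub> x) = t \<otimes>\<^bsub>T\<^esub> l T x"
    if "algebra R T" "x \<in> carrier (obj M T)" "y \<in> carrier (obj M T)" for T x y t
    using l that by (auto simp: module_morphism_def natural_transformation_def scalar_functor_def
        self_algebra_def)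
  have ln: "l U (arr M T U k x) = k (l T x)"
    if "algebra R T" "algebra R U" "k \<in> algebra_hom R T U" "x \<in> carrier (obj M T)" for T U k x
    using l that by (simp add: module_morphism_def natural_transformation_def scalar_functor_def)
  have \<iota>: "\<iota> T t \<in> carrier (obj A T)" if "algebra R T" "t \<in> carrier T" for T t
    using unit_ring_hom[OF that(1)] that(2) by (rule ring_hom_closed)
  note actL = left_module.act_closed[OF left_module_obj] left_module.act_l_distr[OF left_module_obj]
    left_module.act_r_distr[OF left_module_obj] left_module.act_assoc[OF left_module_obj]
  have swap: "act T a (t \<odot>\<^bsub>obj M T\<^esub> m) = t \<odot>\<^bsub>obj M T\<^esub> act T a m"
    if "algebra R T" "t \<in> carrier T" "a \<in> carrier (obj A T)" "m \<in> carrier (obj M T)" for T t a m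
    using that actL(4)[OF that(1,3) \<iota>[OF that(1,2)] that(4)] actL(4)[OF that(1) \<iota>[OF that(1,2)] that(3,4)]
    by (simp add: unit_central act_compatible actL)
  show ?thesis
    by unfold_locales (simp_all add: underlying_module_functor_def l' ln actL \<iota> act_compatible swap
        act_natural[symmetric])
qed

lemma bilinear_form_compose_right:
  assumes "bilinear_form R X N g" and f: "module_morphism R M N f"
  shows "bilinear_form R X M (\<lambda>T a m. g T a (f T m))"
proof -
  interpret bilinear_form R X N g by fact
  have f': "f T (x \<oplus>\<^bsub>obj M T\<^esub> y) = f T x \<oplus>\<^bsub>obj N T\<^esub> f T y"
    "t \<in> carrier T \<Longrightarrow> f T (t \<odot>\<^bsub>obj M T\<^esub> x) = t \<odot>\<^bsub>obj N T\<^esub> f T x"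
    if "algebra R T" "x \<in> carrier (obj M T)" "y \<in> carrier (obj M T)" for T x y t
    using f that by (auto simp: module_morphism_def)
  have fn: "f U (arr M T U k x) = arr N T U k (f T x)"
    if "algebra R T" "algebra R U" "k \<in> algebra_hom R T U" "x \<in> carrier (obj M T)" for T U k x
    using f that by (simp add: module_morphism_def natural_transformation_def)
  note fc = module_morphism_closed[OF f]
  show ?thesis
    by unfold_locales (simp_all add: f' fn fc form_closed add_left add_right smult_left smult_right
        form_natural)
qed

lemma bilinear_form_diff:
  assumes "bilinear_form R X M g" "bilinear_form R X M g'"
  shows "bilinear_form R X M (\<lambda>T a m. g T a m \<ominus>\<^bsub>T\<^esub> g' T a m)"
proof -
  interpret g: bilinear_form R X M g by fact
  interpret g': bilinear_form R X M g' by fact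
  have interchange: "(w \<oplus>\<^bsub>T\<^esub> x) \<ominus>\<^bsub>T\<^esub> (y \<oplus>\<^bsub>T\<^esub> z) = (w \<ominus>\<^bsub>T\<^esub> y) \<oplus>\<^bsub>T\<^esub> (x \<ominus>\<^bsub>T\<^esub> z)"
    and distr: "w \<otimes>\<^bsub>T\<^esub> x \<ominus>\<^bsub>T\<^esub> w \<otimes>\<^bsub>T\<^esub> y = w \<otimes>\<^bsub>T\<^esub> (x \<ominus>\<^bsub>T\<^esub> y)"
    if "algebra R T" "w \<in> carrier T" "x \<in> carrier T" "y \<in> carrier T" "z \<in> carrier T" for T w x y z
  proof -
    interpret algebra R T by fact
    show "(w \<oplus>\<^bsub>T\<^esub> x) \<ominus>\<^bsub>T\<^esub> (y \<oplus>\<^bsub>T\<^esub> z) = (w \<ominus>\<^bsub>T\<^esub> y) \<oplus>\<^bsub>T\<^esub> (x \<ominus>\<^bsub>T\<^esub> z)"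
      using that by (simp add: a_minus_def M.minus_add M.a_ac)
    show "w \<otimes>\<^bsub>T\<^esub> x \<ominus>\<^bsub>T\<^esub> w \<otimes>\<^bsub>T\<^esub> y = w \<otimes>\<^bsub>T\<^esub> (x \<ominus>\<^bsub>T\<^esub> y)"
      using that by (simp add: a_minus_def r_distr r_minus)
  qed
  have closed: "w \<ominus>\<^bsub>T\<^esub> x \<in> carrier T" if "algebra R T" "w \<in> carrier T" "x \<in> carrier T" for T w x
    using that by (intro ring.ring_simprules(4) cring.axioms(1) algebra.M_cring)
  have hom: "k (x \<ominus>\<^bsub>T\<^esub> y) = k x \<ominus>\<^bsub>U\<^esub> k y"
    if "algebra R T" "algebra R U" "k \<in> algebra_hom R T U" "x \<in> carrier T" "y \<in> carrier T" for T U k x y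
  proof -
    interpret T: algebra R T by fact
    interpret U: algebra R U by fact
    interpret ring_hom_cring T U k
      by (intro ring_hom_cring.intro ring_hom_cring_axioms.intro T.M_cring U.M_cring)
        (use that(3) in \<open>simp add: algebra_hom_def\<close>)
    show ?thesis using that(4,5) by (simp add: a_minus_def)
  qed
  show ?thesis
    by unfold_locales (simp_all add: closed interchange distr hom g.form_closed g'.form_closed g.add_left
        g'.add_left g.add_right g'.add_right g.smult_left g'.smult_left g.smult_right g'.smult_right
        g.form_natural g'.form_natural)
qed

theorem proposition5p14:
  fixes R :: "'u ring"
    and A :: "('u, 'a) rng_functor" and \<iota> :: "('u, 'u) module \<Rightarrow> 'u \<Rightarrow> 'a"
    and M :: "('u, 'm) mod_functor" and act :: "('u, 'u) module \<Rightarrow> 'a \<Rightarrow> 'm \<Rightarrow> 'm"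
    and M' :: "('u, 'n) mod_functor" and act' :: "('u, 'u) module \<Rightarrow> 'a \<Rightarrow> 'n \<Rightarrow> 'n"
    and f :: "('u, 'u) module \<Rightarrow> 'm \<Rightarrow> 'n"
  assumes "cring R"
    and "algebra_functor R A \<iota>"
    and "in_family_F TYPE('pa) R (underlying_module_functor A \<iota>)"
    and "algebra_module_functor R A \<iota> M act"
    and "in_family_F TYPE('pm) R M"
    and "algebra_module_functor R A \<iota> M' act'"
    and "in_family_F TYPE('pn) R M'"
    and "module_morphism R M M' f"
  shows "algebra_module_morphism R A M act M' act' f \<longleftrightarrow>
    f (self_algebra R) \<in> left_module_hom (obj A (self_algebra R))
      (obj M (self_algebra R)) (act (self_algebra R))
      (obj M' (self_algebra R)) (act' (self_algebra R))"
proof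
  assume "algebra_module_morphism R A M act M' act' f"
  then show "f (self_algebra R) \<in> left_module_hom (obj A (self_algebra R))
      (obj M (self_algebra R)) (act (self_algebra R))
      (obj M' (self_algebra R)) (act' (self_algebra R))"
    using algebra_self_algebra[OF \<open>cring R\<close>] by (simp add: algebra_module_morphism_def)
next
  let ?R = "self_algebra R"
  assume base: "f ?R \<in> left_module_hom (obj A ?R) (obj M ?R) (act ?R) (obj M' ?R) (act' ?R)"
  note f = \<open>module_morphism R M M' f\<close>
  note fc = module_morphism_closed[OF f]
  interpret M: algebra_module_functor R A \<iota> M act by fact
  interpret M': algebra_module_functor R A \<iota> M' act' by fact
  obtain J p where p: "module_morphism R M' (product_module_functor J) p"
    and inj: "\<And>S. algebra R S \<Longrightarrow> inj_on (p S) (carrier (obj M' S))"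
    by (rule in_family_F_coordinates[OF assms(7)]) (rule that)
  have linear: "f S (act S a x) = act' S a (f S x)"
    if S: "algebra R S" and a: "a \<in> carrier (obj A S)" and x: "x \<in> carrier (obj M S)" for S a x
  proof (rule inj_onD[OF inj[OF S]])
    have fax: "f S (act S a x) \<in> carrier (obj M' S)"
      by (intro fc left_module.act_closed[OF M.left_module_obj] S a x)
    have afx: "act' S a (f S x) \<in> carrier (obj M' S)"
      by (intro fc left_module.act_closed[OF M'.left_module_obj] S a x)
    show "f S (act S a x) \<in> carrier (obj M' S)" "act' S a (f S x) \<in> carrier (obj M' S)"
      by (fact fax afx)+
    have pE: "p S y \<in> J \<rightarrow>\<^sub>E carrier S" if "y \<in> carrier (obj M' S)" for y
      using module_morphism_closed[OF p S that] by (simp add: product_module_functor_simps)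
    show "p S (f S (act S a x)) = p S (act' S a (f S x))"
    proof (rule PiE_ext[OF pE[OF fax] pE[OF afx]])
      fix j assume j: "j \<in> J"
      interpret S: algebra R S by fact
      note q = coordinate_functional[OF p j]
      \<comment> \<open>The \<open>j\<close>-th coordinate of the defect \<open>f(a m) - a f(m)\<close>.\<close>
      let ?g = "\<lambda>T a m. p T (f T (act T a m)) j \<ominus>\<^bsub>T\<^esub> p T (act' T a (f T m)) j"
      have "?g S a x = \<zero>\<^bsub>S\<^esub>"
      proof (rule bilinear_form_determined[OF \<open>cring R\<close> assms(3,5)])
        show "bilinear_form R (underlying_module_functor A \<iota>) M ?g"
          by (intro bilinear_form_diff
              bilinear_form_action[OF assms(4), of "\<lambda>T x. p T (f T x) j"] module_morphism_compose[OF f q]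
              bilinear_form_compose_right[OF _ f, of _ "\<lambda>T a m. p T (act' T a m) j"]
              bilinear_form_action[OF assms(6) q])
        fix b m assume "b \<in> carrier (obj (underlying_module_functor A \<iota>) ?R)" and m: "m \<in> carrier (obj M ?R)"
        then have b: "b \<in> carrier (obj A ?R)" by (simp add: underlying_module_functor_def)
        note RR = algebra_self_algebra[OF \<open>cring R\<close>]
        interpret R: cring ?R by (rule algebra.M_cring[OF RR])
        have "f ?R (act ?R b m) = act' ?R b (f ?R m)"
          using base b m by (simp add: left_module_hom_def)
        moreover have "p ?R (act' ?R b (f ?R m)) j \<in> carrier ?R"
          using module_morphism_closed[OF q RR, of "act' ?R b (f ?R m)"]
            left_module.act_closed[OF M'.left_module_obj[OF RR] b fc[OF RR m]]
          by (simp add: scalar_functor_def self_algebra_def)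
        ultimately have "?g ?R b m = \<zero>\<^bsub>?R\<^esub>" by (simp add: a_minus_def R.r_neg)
        then show "?g ?R b m = \<zero>\<^bsub>R\<^esub>" by (simp add: self_algebra_def)
      qed (use S a x in \<open>simp_all add: underlying_module_functor_def\<close>)
      then show "p S (f S (act S a x)) j = p S (act' S a (f S x)) j"
        using PiE_mem[OF pE[OF fax] j] PiE_mem[OF pE[OF afx] j]
        by (simp add: ring.r_right_minus_eq[OF cring.axioms(1)[OF S.M_cring]])
    qed
  qed
  show "algebra_module_morphism R A M act M' act' f"
    using f linear fc by (auto simp: algebra_module_morphism_def module_morphism_def left_module_hom_def)
qed

end
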